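(* Let $R$ be a discrete valuation ring with fraction field $K$, let $L/K$ be a finite field extension, and let $S$ be the integral closure of $R$ in $L$. Let $A,B\in\mathrm{Mat}_n(R)$ have the same characteristic polynomial, and assume this polynomial is separable. If $A$ and $B$ are similar over $S$ (i.e. $B=UAU^{-1}$ for some $U\in\mathrm{GL}_n(S)$), then $A$ and $B$ are similar over $R$. *)

theory Defs
  imports
    "Jordan_Normal_Form.Char_Poly"
    "HOL-Computational_Algebra.Polynomial_Factorial"
begin

context comm_ring_1
begin

definition is_ideal :: "'a set \<Rightarrow> bool" where
  "is_ideal I \<longleftrightarrow>
     0 \<in> I \<and> (\<forall>x\<in>I. \<forall>y\<in>I. x + y \<in> I) \<and> (\<forall>r. \<forall>x\<in>I. r * x \<in> I)"

definition is_principal_ideal :: "'a set \<Rightarrow> bool" where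
  "is_principal_ideal I \<longleftrightarrow> (\<exists>a. I = {r * a |r. True})"

definition is_prime_ideal :: "'a set \<Rightarrow> bool" where
  "is_prime_ideal P \<longleftrightarrow>
     is_ideal P \<and> 1 \<notin> P \<and> (\<forall>x y. x * y \<in> P \<longrightarrow> x \<in> P \<or> y \<in> P)"

end

text \<open>A discrete valuation ring is a principal ideal domain with exactly one nonzero
  prime ideal. In particular it is not a field.\<close>

class discrete_valuation_ring = idom +
  assumes ideal_principal: "is_ideal I \<Longrightarrow> is_principal_ideal I"
    and unique_nonzero_prime_ideal: "\<exists>!P. is_prime_ideal P \<and> P \<noteq> {0}"

text \<open>A field extension \<open>L/K\<close> is given by its structure map \<open>\<phi> : K \<rightarrow> L\<close>, which makes
  \<open>L\<close> a \<open>K\<close>-vector space via \<open>c \<cdot> x = \<phi> c * x\<close>.\<close>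

definition finite_field_extension :: "('k::field \<Rightarrow> 'l::field) \<Rightarrow> bool" where
  "finite_field_extension \<phi> \<longleftrightarrow>
     field_hom \<phi> \<and> (\<exists>X. finite X \<and> module.span (\<lambda>c x. \<phi> c * x) X = UNIV)"

text \<open>The integral closure of \<open>R\<close> in an \<open>R\<close>-algebra with structure map \<open>h\<close>.\<close>

definition integral_closure :: "('r::comm_ring_1 \<Rightarrow> 'l::comm_ring_1) \<Rightarrow> 'l set" where
  "integral_closure h = {x. \<exists>p. monic p \<and> poly (map_poly h p) x = 0}"

definition separable_poly :: "'k::field poly \<Rightarrow> bool" where
  "separable_poly f \<longleftrightarrow> coprime f (pderiv f)"

text \<open>Similarity by a matrix in \<open>GL\<^sub>n(S)\<close>, for a subring \<open>S\<close> of the ambient ring: both the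
  conjugating matrix and its inverse have entries in \<open>S\<close>.\<close>

definition similar_mat_over :: "'l::comm_ring_1 set \<Rightarrow> 'l mat \<Rightarrow> 'l mat \<Rightarrow> bool" where
  "similar_mat_over S A B \<longleftrightarrow>
     (\<exists>P Q. elements_mat P \<subseteq> S \<and> elements_mat Q \<subseteq> S \<and> similar_mat_wit A B P Q)"

end

theory Submission
  imports Defs "HOL-Algebra.Algebraic_Closure_Type"
begin

text \<open>Let \<open>H\<close> be the \<open>R\<close>-module of matrices \<open>X\<close> with \<open>B * X = X * A\<close>, \<open>H'\<close> that of the \<open>Y\<close> with
  \<open>A * Y = Y * B\<close>, and \<open>E\<close> the commutant of \<open>A\<close>. Separability makes \<open>E\<close> commutative, because over an
  algebraic closure \<open>A\<close> is diagonalisable with distinct eigenvalues.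

  The entries of the conjugating matrix span a finitely generated \<open>R\<close>-submodule of \<open>L\<close>, which is free
  since \<open>R\<close> is a valuation ring. Expanding in a basis writes the conjugating matrix as an \<open>S\<close>-linear
  combination of elements of \<open>H\<close>, and likewise its inverse with \<open>H'\<close>. So \<open>1\<close> is an \<open>S\<close>-linear
  combination of products \<open>Y * X\<close>, and by Nakayama's lemma these products generate the unit ideal of
  the image \<open>C\<close> of \<open>E\<close> in the matrices over the residue field \<open>k\<close>.

  \<open>C\<close> is a commutative finite-dimensional \<open>k\<close>-algebra. Adding orthogonal idempotents one at a time, one
  finds a single pair with \<open>Y * X = 1\<close> over \<open>k\<close>. A lift of
  \<open>X\<close> to \<open>H\<close> has unit determinant and conjugates \<open>A\<close> into \<open>B\<close> over \<open>R\<close>.\<close>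

hide_const (open) Coset.order Polynomials.degree Polynomials.lead_coeff up_ring.coeff module.smult
no_notation Polynomials.var (\<open>X\<index>\<close>)
no_notation fps_nth (infixl \<open>$\<close> 75)

subsection \<open>Discrete valuation rings and their residue fields\<close>

lemma (in comm_ring_1) is_ideal_principal: "is_ideal {r * a |r. True}"
  unfolding is_ideal_def
proof (intro conjI ballI allI)
  show "0 \<in> {r * a |r. True}"
    using mult_zero_left[of a, symmetric] by blast
  show "x + y \<in> {r * a |r. True}" if "x \<in> {r * a |r. True}" "y \<in> {r * a |r. True}" for x y
    using that by (auto simp: distrib_right[symmetric])
  show "r * x \<in> {r * a |r. True}" if "x \<in> {r * a |r. True}" for r x
    using that by (auto simp: mult.assoc[symmetric])
qed

lemma (in comm_ring_1) is_ideal_add_principal: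
  assumes "is_ideal I"
  shows "is_ideal {x + r * a |x r. x \<in> I}"
  unfolding is_ideal_def
proof (intro conjI ballI allI)
  let ?J = "{x + r * a |x r. x \<in> I}"
  have I: "0 \<in> I" "\<And>x y. x \<in> I \<Longrightarrow> y \<in> I \<Longrightarrow> x + y \<in> I" "\<And>r x. x \<in> I \<Longrightarrow> r * x \<in> I"
    using assms unfolding is_ideal_def by auto
  have "0 = 0 + 0 * a" by simp
  with I(1) show "0 \<in> ?J" by blast
  show "x + y \<in> ?J" if "x \<in> ?J" "y \<in> ?J" for x y
  proof -
    from that obtain x1 r1 x2 r2 where x: "x1 \<in> I" "x = x1 + r1 * a" and y: "x2 \<in> I" "y = x2 + r2 * a"
      by auto
    then have "x + y = (x1 + x2) + (r1 + r2) * a" by (simp add: algebra_simps)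
    with I(2)[OF x(1) y(1)] show ?thesis by blast
  qed
  show "r * x \<in> ?J" if "x \<in> ?J" for r x
  proof -
    from that obtain x1 r1 where x: "x1 \<in> I" "x = x1 + r1 * a" by auto
    then have "r * x = r * x1 + (r * r1) * a" by (simp add: algebra_simps)
    with I(3)[OF x(1)] show ?thesis by blast
  qed
qed

text \<open>Zorn's lemma gives an ideal \<open>M\<close> maximal among those that contain
  \<open>a\<close> and avoid \<open>1\<close>. It is prime: if \<open>x\<close> is outside
  \<open>M\<close>, then \<open>1 = m + r * x\<close> with \<open>m\<close> in \<open>M\<close>, and
  multiplying by \<open>y\<close> puts \<open>y\<close> in \<open>M\<close> as soon as
  \<open>x * y\<close> is there.\<close>

lemma (in comm_ring_1) ex_prime_ideal_containing:
  assumes "\<not> a dvd 1"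
  shows "\<exists>P. is_prime_ideal P \<and> a \<in> P"
proof -
  let ?A = "{I. is_ideal I \<and> 1 \<notin> I \<and> a \<in> I}"
  have "{r * a |r. True} \<in> ?A"
  proof -
    have "a = 1 * a" by simp
    moreover have "1 \<notin> {r * a |r. True}"
    proof
      assume "1 \<in> {r * a |r. True}"
      then obtain r where "1 = r * a" by blast
      then have "a dvd 1" by (metis dvd_triv_right)
      with assms show False ..
    qed
    ultimately show ?thesis using is_ideal_principal by blast
  qed
  then have "\<exists>M\<in>?A. \<forall>X\<in>?A. M \<subseteq> X \<longrightarrow> X = M"
  proof (intro subset_Zorn_nonempty)
    fix \<C> assume ne: "\<C> \<noteq> {}" and chain: "subset.chain ?A \<C>"
    have sub: "\<C> \<subseteq> ?A" and comp: "\<And>X Y. X \<in> \<C> \<Longrightarrow> Y \<in> \<C> \<Longrightarrow> X \<subseteq> Y \<or> Y \<subseteq> X"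
      using chain by (auto simp: subset_chain_def)
    have "is_ideal (\<Union>\<C>)"
      unfolding is_ideal_def
    proof (intro conjI ballI allI)
      show "0 \<in> \<Union>\<C>" using ne sub unfolding is_ideal_def by blast
      show "r * x \<in> \<Union>\<C>" if "x \<in> \<Union>\<C>" for r x using that sub unfolding is_ideal_def by blast
      fix x y assume "x \<in> \<Union>\<C>" "y \<in> \<Union>\<C>"
      then obtain X Y where XY: "X \<in> \<C>" "Y \<in> \<C>" "x \<in> X" "y \<in> Y" by blast
      then obtain Z where Z: "Z \<in> \<C>" "x \<in> Z" "y \<in> Z" using comp[of X Y] by blast
      then have "is_ideal Z" using sub by auto
      with Z show "x + y \<in> \<Union>\<C>" unfolding is_ideal_def by blast
    qed
    then show "\<Union>\<C> \<in> ?A" using ne sub by blast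
  qed auto
  then obtain M where M: "is_ideal M" "1 \<notin> M" "a \<in> M"
    and max: "\<And>X. is_ideal X \<Longrightarrow> 1 \<notin> X \<Longrightarrow> a \<in> X \<Longrightarrow> M \<subseteq> X \<Longrightarrow> X = M" by auto
  have "x \<in> M \<or> y \<in> M" if xy: "x * y \<in> M" for x y
  proof (rule ccontr)
    assume "\<not> (x \<in> M \<or> y \<in> M)"
    then have nx: "x \<notin> M" and ny: "y \<notin> M" by auto
    let ?J = "{m + r * x |m r. m \<in> M}"
    have sub: "M \<subseteq> ?J"
    proof
      fix m assume "m \<in> M"
      moreover have "m = m + 0 * x" by simp
      ultimately show "m \<in> ?J" by blast
    qed
    have "x = 0 + 1 * x" by simp
    then have "x \<in> ?J" using M(1) unfolding is_ideal_def by blast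
    then have "?J \<noteq> M" using nx by blast
    then have "1 \<in> ?J" using max[OF is_ideal_add_principal[OF M(1)]] sub M(3) by blast
    then obtain m r where m: "m \<in> M" "1 = m + r * x" by blast
    have "y = (m + r * x) * y" using m(2)[symmetric] by simp
    also have "\<dots> = y * m + r * (x * y)" by (simp add: algebra_simps)
    also have "\<dots> \<in> M" using M(1) m(1) xy unfolding is_ideal_def by blast
    finally show False using ny by simp
  qed
  with M show ?thesis unfolding is_prime_ideal_def by blast
qed

section \<open>Discrete valuation rings: locality and total divisibility\<close>

context discrete_valuation_ring
begin

text \<open>A nonzero nonunit lies in some prime ideal, which is then nonzero and hence the unique
  \<open>P\<close>. So all nonunits lie in \<open>P\<close>, which is closed under addition and
  contains no unit.\<close>

lemma nonunit_add:
  assumes "\<not> a dvd 1" "\<not> b dvd 1"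
  shows "\<not> (a + b) dvd 1"
proof -
  obtain P where P: "is_prime_ideal P" "P \<noteq> {0}"
    and uniq: "\<And>Q. is_prime_ideal Q \<Longrightarrow> Q \<noteq> {0} \<Longrightarrow> Q = P"
    using unique_nonzero_prime_ideal by blast
  have P': "0 \<in> P" "1 \<notin> P" "\<And>x y. x \<in> P \<Longrightarrow> y \<in> P \<Longrightarrow> x + y \<in> P" "\<And>r x. x \<in> P \<Longrightarrow> r * x \<in> P"
    using P(1) unfolding is_prime_ideal_def is_ideal_def by auto
  have nonunit: "x \<in> P" if "\<not> x dvd 1" for x
  proof (cases "x = 0")
    case False
    with ex_prime_ideal_containing[OF that] uniq show ?thesis by blast
  qed (use P' in simp)
  have "a + b \<in> P" using assms by (intro P'(3) nonunit)
  show ?thesis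
  proof
    assume "(a + b) dvd 1"
    then obtain c where "1 = c * (a + b)" by (metis dvdE mult.commute)
    with P'(4)[OF \<open>a + b \<in> P\<close>, of c] P'(2) show False by simp
  qed
qed

lemma nonunit_sum:
  assumes "\<And>x. x \<in> F \<Longrightarrow> \<not> f x dvd 1"
  shows "\<not> sum f F dvd 1"
  using assms by (induction F rule: infinite_finite_induct) (auto simp: nonunit_add)

text \<open>The ideal generated by \<open>a\<close> and \<open>b\<close> is principal, say with
  generator \<open>d\<close>. Cancelling \<open>d\<close> leaves \<open>u * a' + v * b' = 1\<close>
  for the cofactors, and since nonunits are closed under addition, \<open>a'\<close> or
  \<open>b'\<close> is a unit.\<close>

lemma dvd_linear: "a dvd b \<or> b dvd a"
proof (cases "a = 0")
  case False
  have "is_ideal {x + r * b |x r. x \<in> {r * a |r. True}}"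
    by (intro is_ideal_add_principal is_ideal_principal)
  then obtain d where d: "{x + r * b |x r. x \<in> {r * a |r. True}} = {r * d |r. True}"
    using ideal_principal unfolding is_principal_ideal_def by blast
  have "a \<in> {r * d |r. True}" unfolding d[symmetric]
    by (rule CollectI, rule exI[of _ a], rule exI[of _ 0]) (auto intro: exI[of _ 1])
  then obtain a' where a: "a = a' * d" by blast
  have "b \<in> {r * d |r. True}" unfolding d[symmetric]
    by (rule CollectI, rule exI[of _ 0], rule exI[of _ 1]) (auto intro: exI[of _ 0])
  then obtain b' where b: "b = b' * d" by blast
  have "d \<in> {x + r * b |x r. x \<in> {r * a |r. True}}" unfolding d by (auto intro!: exI[of _ 1])
  then obtain u v where "d = u * a + v * b" by blast
  then have "(u * a' + v * b') * d = 1 * d" unfolding a b by (simp add: algebra_simps)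
  moreover have "d \<noteq> 0" using False a by auto
  ultimately have "u * a' + v * b' = 1" by simp
  then have "a' dvd 1 \<or> b' dvd 1"
    using nonunit_add[of "u * a'" "v * b'"] by (metis dvd_mult_right dvd_refl)
  then show ?thesis
  proof
    assume "a' dvd 1"
    then have "a' dvd b'" by (rule dvd_trans) simp
    then show ?thesis unfolding a b by (auto intro: mult_dvd_mono)
  next
    assume "b' dvd 1"
    then have "b' dvd a'" by (rule dvd_trans) simp
    then show ?thesis unfolding a b by (auto intro: mult_dvd_mono)
  qed
qed simp

lemma ex_minimal_dvd:
  assumes "finite F" "F \<noteq> {}"
  shows "\<exists>x\<in>F. \<forall>y\<in>F. f x dvd f y"
  using assms
proof (induction F rule: finite_ne_induct)
  case (insert x F)
  then obtain z where z: "z \<in> F" "\<forall>y\<in>F. f z dvd f y" by blast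
  show ?case
  proof (cases "f z dvd f x")
    case False
    then have "f x dvd f z" using dvd_linear by blast
    with z show ?thesis by (auto intro: dvd_trans)
  qed (use z in auto)
qed simp

end

\<comment> \<open>This is congruence modulo the maximal ideal, which consists of the nonunits.
  Transitivity is the closure of nonunits under addition.\<close>
quotient_type (overloaded) 'a residue_field = "'a::discrete_valuation_ring" / "\<lambda>a b. \<not> (a - b) dvd 1"
proof (intro equivpI reflpI sympI transpI)
  show "\<not> (y - x) dvd 1" if "\<not> (x - y) dvd 1" for x y :: 'a
    using that by (metis minus_diff_eq minus_dvd_iff)
  show "\<not> (x - z) dvd 1" if "\<not> (x - y) dvd 1" "\<not> (y - z) dvd 1" for x y z :: 'a
    using nonunit_add[OF that] by simp
qed simp

instantiation residue_field :: (discrete_valuation_ring) field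
begin

lift_definition zero_residue_field :: "'a residue_field" is 0 .
lift_definition one_residue_field :: "'a residue_field" is 1 .

lift_definition plus_residue_field :: "'a residue_field \<Rightarrow> 'a residue_field \<Rightarrow> 'a residue_field" is "(+)"
proof -
  fix a b c d :: 'a
  assume "\<not> (a - b) dvd 1" "\<not> (c - d) dvd 1"
  from nonunit_add[OF this] show "\<not> (a + c - (b + d)) dvd 1" by (simp add: algebra_simps)
qed

lift_definition uminus_residue_field :: "'a residue_field \<Rightarrow> 'a residue_field" is uminus
  by (metis minus_diff_eq minus_diff_minus minus_dvd_iff)

lift_definition minus_residue_field :: "'a residue_field \<Rightarrow> 'a residue_field \<Rightarrow> 'a residue_field" is "(-)"
proof -
  fix a b c d :: 'a
  assume "\<not> (a - b) dvd 1" "\<not> (c - d) dvd 1"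
  then have "\<not> (a - b) dvd 1" "\<not> (d - c) dvd 1" by (metis minus_diff_eq minus_dvd_iff)+
  from nonunit_add[OF this] show "\<not> (a - c - (b - d)) dvd 1" by (simp add: algebra_simps)
qed

lift_definition times_residue_field :: "'a residue_field \<Rightarrow> 'a residue_field \<Rightarrow> 'a residue_field" is "(*)"
proof -
  fix a b c d :: 'a
  assume "\<not> (a - b) dvd 1" "\<not> (c - d) dvd 1"
  then have "\<not> (a - b) * c dvd 1" "\<not> b * (c - d) dvd 1" by (meson dvd_mult_left dvd_mult_right)+
  from nonunit_add[OF this] show "\<not> (a * c - b * d) dvd 1" by (simp add: algebra_simps)
qed

lift_definition inverse_residue_field :: "'a residue_field \<Rightarrow> 'a residue_field"
  is "\<lambda>a. if a dvd 1 then SOME b. a * b = 1 else 0"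
proof -
  fix a b :: 'a
  assume ab: "\<not> (a - b) dvd 1"
  then have ba: "\<not> (b - a) dvd 1" by (metis minus_diff_eq minus_dvd_iff)
  \<comment> \<open>If \<open>b\<close> is a nonunit, so is \<open>a = (a - b) + b\<close>, and
    conversely: being a unit depends only on the class.\<close>
  have iff: "a dvd 1 \<longleftrightarrow> b dvd 1"
    using nonunit_add[OF ab, of b] nonunit_add[OF ba, of a] by auto
  show "\<not> ((if a dvd 1 then SOME b. a * b = 1 else 0) - (if b dvd 1 then SOME c. b * c = 1 else 0)) dvd 1"
  proof (cases "a dvd 1")
    case True
    with iff have b: "b dvd 1" by simp
    define a' where "a' = (SOME c. a * c = 1)"
    define b' where "b' = (SOME c. b * c = 1)"
    have "\<exists>c. a * c = 1" "\<exists>c. b * c = 1" using True b by (metis dvdE)+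
    then have a': "a * a' = 1" and b': "b * b' = 1" unfolding a'_def b'_def by (metis (mono_tags, lifting) someI_ex)+
    \<comment> \<open>The two chosen inverses differ by a multiple of the nonunit
      \<open>b - a\<close>, so they are congruent whatever the choice.\<close>
    have "(b - a) * (a' * b') = (b * b') * a' - (a * a') * b'" by (simp add: algebra_simps)
    also have "\<dots> = a' - b'" using a' b' by simp
    finally have "\<not> (a' - b') dvd 1" using ba by (metis dvd_mult_left)
    then show ?thesis using True b by (simp add: a'_def b'_def)
  qed (use iff in simp)
qed

definition divide_residue_field :: "'a residue_field \<Rightarrow> 'a residue_field \<Rightarrow> 'a residue_field" where
  "divide_residue_field x y = x * inverse y"

instance
proof
  fix a b c :: "'a residue_field"
  show "a * b * c = a * (b * c)" by transfer (simp add: algebra_simps)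
  show "a * b = b * a" by transfer (simp add: algebra_simps)
  show "1 * a = a" by transfer simp
  show "a + b + c = a + (b + c)" by transfer (simp add: algebra_simps)
  show "a + b = b + a" by transfer (simp add: algebra_simps)
  show "0 + a = a" by transfer simp
  show "- a + a = 0" by transfer simp
  show "a - b = a + - b" by transfer simp
  show "(a + b) * c = a * c + b * c" by transfer (simp add: algebra_simps)
  show "(0::'a residue_field) \<noteq> 1" by transfer simp
  show "a div b = a * inverse b" by (rule divide_residue_field_def)
  show "inverse (0::'a residue_field) = 0" by transfer simp
  show "inverse a * a = 1" if "a \<noteq> 0"
    using that
  proof transfer
    fix a :: 'a assume "\<not> \<not> (a - 0) dvd 1"
    then have "a dvd 1" by simp
    then have "\<exists>c. a * c = 1" by (metis dvdE)
    then have "a * (SOME c. a * c = 1) = 1" by (rule someI_ex)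
    then show "\<not> ((if a dvd 1 then SOME b. a * b = 1 else 0) * a - 1) dvd 1"
      using \<open>a dvd 1\<close> by (simp add: mult.commute)
  qed
qed

end

lift_definition residue :: "'a::discrete_valuation_ring \<Rightarrow> 'a residue_field" is "\<lambda>x. x" .

lemma surj_residue: "surj residue"
  by (metis Quotient_residue_field Quotient_abs_rep residue.abs_eq surj_def)

lemma residue_eq_0_iff: "residue x = 0 \<longleftrightarrow> \<not> x dvd 1"
  by transfer simp

interpretation residue: comm_ring_hom residue
  by standard (transfer; simp)+

subsection \<open>Integral elements and intertwiners over an extension field\<close>

lemma index_mult_mat_sum:
  assumes "C \<in> carrier_mat n m" "D \<in> carrier_mat m k" "i < n" "j < k"
  shows "(C * D) $$ (i, j) = (\<Sum>l<m. C $$ (i, l) * D $$ (l, j))"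
  using assms by (simp add: scalar_prod_def atLeast0LessThan)

section \<open>The field as a torsion-free module over the valuation ring\<close>

locale dvr_field_hom = comm_ring_hom h for h :: "'r::discrete_valuation_ring \<Rightarrow> 'l::field" +
  assumes hom_eq_0: "h x = 0 \<Longrightarrow> x = 0"
begin

sublocale M: Modules.module "\<lambda>r x. h r * x"
  by standard (simp_all add: algebra_simps hom_distribs)

declare M.scale_scale [simp del]

text \<open>Over a valuation ring, a dependency relation can be divided by its coefficient of least
  valuation, which makes one of the generators redundant.\<close>

lemma ex_independent_spanning_subset:
  assumes "finite U"
  shows "\<exists>V\<subseteq>U. M.independent V \<and> U \<subseteq> M.span V"
proof -
  let ?P = "\<lambda>V. V \<subseteq> U \<and> U \<subseteq> M.span V"
  have "?P U" using M.span_superset by simp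
  \<comment> \<open>A spanning subset of least cardinality contains no redundant generator.\<close>
  then obtain V where V: "?P V" and min: "\<And>V'. ?P V' \<Longrightarrow> card V \<le> card V'"
    using ex_has_least_nat[of ?P U card] by (elim exE conjE) auto
  have fin: "finite V" using V assms finite_subset by blast
  have "M.independent V"
  proof
    assume "M.dependent V"
    then obtain u where u: "\<exists>v\<in>V. u v \<noteq> 0" "(\<Sum>v\<in>V. h (u v) * v) = 0"
      unfolding M.dependent_finite[OF fin] by blast
    then obtain w where w: "w \<in> V" and dvd: "\<And>v. v \<in> V \<Longrightarrow> u w dvd u v"
      using ex_minimal_dvd[OF fin, of u] by blast
    \<comment> \<open>The coefficient \<open>u w\<close> divides all others, so it could vanish only
      if they all did.\<close>
    have uw: "u w \<noteq> 0" using u(1) dvd by force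
    define q where "q v = (SOME c. u v = u w * c)" for v
    have q: "u v = u w * q v" if "v \<in> V" for v
      unfolding q_def using dvd[OF that] by (metis (mono_tags, lifting) dvdE someI_ex)
    have qw: "q w = 1" using q[OF w] uw by simp
    have "h (u w) * (\<Sum>v\<in>V. h (q v) * v) = (\<Sum>v\<in>V. h (u v) * v)"
      unfolding sum_distrib_left by (intro sum.cong refl) (simp add: q hom_mult mult.assoc)
    then have "(\<Sum>v\<in>V. h (q v) * v) = 0" using u(2) uw hom_eq_0 by auto
    then have "w + (\<Sum>v\<in>V - {w}. h (q v) * v) = 0"
      by (subst (asm) sum.remove[OF fin w]) (simp add: qw)
    then have "w = - (\<Sum>v\<in>V - {w}. h (q v) * v)" by (rule eq_neg_iff_add_eq_0[THEN iffD2])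
    also have "\<dots> \<in> M.span (V - {w})"
      by (intro M.span_neg M.span_sum M.span_scale M.span_base)
    finally have "w \<in> M.span (V - {w})" .
    moreover have "v \<in> M.span (V - {w})" if "v \<in> V" "v \<noteq> w" for v
      using that by (intro M.span_base) simp
    ultimately have "V \<subseteq> M.span (V - {w})" by blast
    then have "M.span V \<subseteq> M.span (V - {w})" by (simp add: M.span_minimal)
    then have "V - {w} \<subseteq> U" "U \<subseteq> M.span (V - {w})" using V by auto
    then have "card V \<le> card (V - {w})" by (intro min conjI)
    then show False using card_Diff1_less[OF fin w] by simp
  qed
  with V show ?thesis by blast
qed

text \<open>The algebra generated by finitely many integral elements is a finite module. When
  \<open>x\<close> with a monic equation of degree \<open>d\<close> is adjoined, it suffices to
  multiply the old generators by \<open>x ^ i\<close> for \<open>i < d\<close>, because the equation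
  rewrites \<open>x ^ d\<close> in lower powers.\<close>

lemma ex_finite_stable_span:
  assumes "finite T" "T \<subseteq> integral_closure h"
  shows "\<exists>G. finite G \<and> 1 \<in> M.span G \<and> (\<forall>s\<in>T. \<forall>g\<in>M.span G. s * g \<in> M.span G)"
  using assms
proof (induction T rule: finite_induct)
  case empty
  show ?case by (intro exI[of _ "{1}"]) (auto intro: M.span_base)
next
  case (insert x T)
  then obtain G where G: "finite G" "1 \<in> M.span G" and stable: "\<And>s g. s \<in> T \<Longrightarrow> g \<in> M.span G \<Longrightarrow> s * g \<in> M.span G"
    by auto
  from insert.prems obtain p where p: "monic p" "poly (map_poly h p) x = 0"
    unfolding integral_closure_def by blast
  define d where "d = degree p"
  have "degree (map_poly h p) = d" unfolding d_def by (rule degree_map_poly) (auto dest: hom_eq_0)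
  then have "0 = (\<Sum>i\<le>d. h (coeff p i) * x ^ i)"
    using p(2) by (simp add: poly_altdef coeff_map_poly)
  also have "\<dots> = (\<Sum>i<d. h (coeff p i) * x ^ i) + x ^ d"
    using p(1) by (simp add: lessThan_Suc_atMost[symmetric] d_def)
  finally have rel: "x ^ d = - (\<Sum>i<d. h (coeff p i) * x ^ i)"
    by (simp add: add_eq_0_iff)
  \<comment> \<open>For \<open>d = 0\<close> the relation would read \<open>1 = 0\<close>. With
    \<open>d\<close> positive the exponent \<open>0\<close> is available, so \<open>1\<close> stays
    in the new span.\<close>
  have "d \<noteq> 0" using rel by (intro notI) simp
  define G' where "G' = (\<lambda>(i, g). x ^ i * g) ` ({..<d} \<times> G)"
  have low: "x ^ i * g \<in> M.span G'" if "i < d" "g \<in> M.span G" for i g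
    using that(2)
  proof (induction rule: M.span_induct_alt)
    case base show ?case by (simp add: M.span_zero)
  next
    case (step c y z)
    then have "x ^ i * y \<in> M.span G'" using that(1) by (intro M.span_base) (auto simp: G'_def)
    from M.span_add[OF M.span_scale[OF this, of c] step(2)] show ?case
      by (simp add: algebra_simps)
  qed
  have "s * g \<in> M.span G'" if s: "s \<in> insert x T" and g: "g \<in> M.span G'" for s g
    using g
  proof (induction rule: M.span_induct_alt)
    case base show ?case by (simp add: M.span_zero)
  next
    case (step c y z)
    then obtain i g where y: "y = x ^ i * g" "i < d" "g \<in> G" by (auto simp: G'_def)
    have "s * y \<in> M.span G'"
    proof (cases "s \<in> T")
      case True
      have "x ^ i * (s * g) \<in> M.span G'" using stable[OF True M.span_base[OF y(3)]] y(2) by (rule low[rotated])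
      then show ?thesis by (simp add: y(1) mult_ac)
    next
      case False
      with s have s: "s = x" by simp
      show ?thesis
      proof (cases "Suc i < d")
        case True
        from low[OF this M.span_base[OF y(3)]] show ?thesis by (simp add: s y(1) mult_ac)
      next
        case False
        then have "Suc i = d" using y(2) by simp
        then have "s * y = x ^ d * g" by (auto simp: s y(1))
        also have "\<dots> = - (\<Sum>i<d. h (coeff p i) * (x ^ i * g))"
          by (simp add: rel sum_distrib_right mult.assoc)
        also have "\<dots> \<in> M.span G'"
          by (intro M.span_neg M.span_sum M.span_scale low) (auto intro: M.span_base y)
        finally show ?thesis .
      qed
    qed
    from M.span_add[OF M.span_scale[OF this, of c] step(2)] show ?case
      by (simp add: algebra_simps)
  qed
  moreover have "1 \<in> M.span G'" using low[of 0, OF _ G(2)] \<open>d \<noteq> 0\<close> by simp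
  moreover have "finite G'" using G(1) by (simp add: G'_def)
  ultimately show ?case by blast
qed

text \<open>This is Nakayama's lemma for the subring of \<open>'l\<close> generated by finitely many integral elements,
  read off on a basis.\<close>

lemma nonunit_if_nonunit_combination:
  assumes T: "finite T" "T \<subseteq> integral_closure h"
    and y: "\<And>x. x \<in> F \<Longrightarrow> \<exists>s\<in>T. \<exists>t\<in>T. y x = s * t"
    and m: "\<And>x. x \<in> F \<Longrightarrow> \<not> m x dvd 1"
    and eq: "(\<Sum>x\<in>F. h (m x) * y x) = h u"
  shows "\<not> u dvd 1"
proof -
  obtain G where G: "finite G" "1 \<in> M.span G" and stable: "\<And>s g. s \<in> T \<Longrightarrow> g \<in> M.span G \<Longrightarrow> s * g \<in> M.span G"
    using ex_finite_stable_span[OF T] by blast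
  obtain V where V: "V \<subseteq> G" "M.independent V" "G \<subseteq> M.span V"
    using ex_independent_spanning_subset[OF G(1)] by blast
  have span: "M.span V = M.span G"
    using V by (metis M.span_mono M.span_minimal M.subspace_span subset_antisym)
  have finV: "finite V" using V(1) G(1) finite_subset by blast
  have "V \<noteq> {}"
  proof
    assume "V = {}"
    then have "M.span G = {0}" using span by simp
    with G(2) show False by simp
  qed
  \<comment> \<open>Any basis element will do: multiplication by each \<open>y x\<close> keeps
    \<open>v\<close> in the span, and coefficients at \<open>v\<close> are compared below.\<close>
  then obtain v where v: "v \<in> V" by blast
  have "\<exists>r. y x * v = (\<Sum>w\<in>V. h (r w) * w)" if x: "x \<in> F" for x
  proof -
    from y[OF x] obtain s t where "s \<in> T" "t \<in> T" "y x = s * t" by blast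
    then have "y x * v \<in> M.span V"
      using stable[OF _ stable[OF _ M.span_base[of v G]]] v V(1) by (auto simp: span mult.assoc)
    then show ?thesis using M.span_finite[OF finV] by auto
  qed
  then obtain r where r: "\<And>x. x \<in> F \<Longrightarrow> y x * v = (\<Sum>w\<in>V. h (r x w) * w)" by metis
  \<comment> \<open>These are the coefficients in the basis \<open>V\<close> of the relation
    obtained by multiplying \<open>eq\<close> by \<open>v\<close>. Independence makes the one at
    \<open>v\<close> vanish, which expresses \<open>u\<close> through the nonunits
    \<open>m x\<close>.\<close>
  define c where "c w = (\<Sum>x\<in>F. m x * r x w) - (if w = v then u else 0)" for w
  have "h u * v = (\<Sum>x\<in>F. h (m x) * (y x * v))"
    unfolding eq[symmetric] by (simp add: sum_distrib_right mult.assoc)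
  also have "\<dots> = (\<Sum>x\<in>F. \<Sum>w\<in>V. h (m x * r x w) * w)"
    by (intro sum.cong refl) (simp add: r sum_distrib_left hom_mult mult.assoc)
  also have "\<dots> = (\<Sum>w\<in>V. h (\<Sum>x\<in>F. m x * r x w) * w)"
    by (subst sum.swap) (simp add: hom_sum sum_distrib_right)
  finally have "(\<Sum>w\<in>V. h (\<Sum>x\<in>F. m x * r x w) * w) - h u * v = 0" by simp
  moreover have "(\<Sum>w\<in>V. h (if w = v then u else 0) * w) = h u * v"
    using finV v by (simp add: if_distrib[of h] if_distrib[of "\<lambda>a. a * _"] cong: if_cong)
  ultimately have "(\<Sum>w\<in>V. h (c w) * w) = 0"
    by (simp add: c_def hom_minus left_diff_distrib sum_subtractf)
  then have "c v = 0"
    using V(2) v unfolding M.dependent_finite[OF finV] by blast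
  then have "u = (\<Sum>x\<in>F. m x * r x v)" by (simp add: c_def)
  also have "\<not> \<dots> dvd 1"
    using m by (intro nonunit_sum) (meson dvd_mult_left)
  finally show ?thesis .
qed

text \<open>The intertwining equation is linear with coefficients in the valuation ring. Expanding
  the entries of \<open>P\<close> in a basis \<open>V\<close> of their span and comparing
  coefficients, each coefficient matrix \<open>X s\<close> satisfies it. Taking \<open>V\<close>
  among the entries of \<open>P\<close> makes its elements integral whenever those entries
  are.\<close>

lemma intertwiner_decomposition:
  fixes A B :: "'r mat"
  assumes P: "P \<in> carrier_mat n n" and A: "A \<in> carrier_mat n n" and B: "B \<in> carrier_mat n n"
    and comm: "map_mat h B * P = P * map_mat h A"
  obtains V X where "finite V" "V \<subseteq> elements_mat P"
    "\<And>s. s \<in> V \<Longrightarrow> X s \<in> carrier_mat n n" "\<And>s. s \<in> V \<Longrightarrow> B * X s = X s * A"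
    "\<And>i j. i < n \<Longrightarrow> j < n \<Longrightarrow> P $$ (i, j) = (\<Sum>s\<in>V. h (X s $$ (i, j)) * s)"
proof -
  have fin: "finite (elements_mat P)" unfolding elements_mat_def by simp
  obtain V where V: "V \<subseteq> elements_mat P" "M.independent V" "elements_mat P \<subseteq> M.span V"
    using ex_independent_spanning_subset[OF fin] by blast
  have finV: "finite V" using V(1) fin finite_subset by blast
  have "\<exists>r. P $$ (i, j) = (\<Sum>s\<in>V. h (r s) * s)" if "i < n" "j < n" for i j
  proof -
    have "P $$ (i, j) \<in> elements_mat P" using that P by auto
    then have "P $$ (i, j) \<in> M.span V" using V(3) by blast
    then show ?thesis using M.span_finite[OF finV] by auto
  qed
  then obtain r where r: "\<And>i j. i < n \<Longrightarrow> j < n \<Longrightarrow> P $$ (i, j) = (\<Sum>s\<in>V. h (r i j s) * s)" by metis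
  define X where "X s = mat n n (\<lambda>(i, j). r i j s)" for s
  have X: "X s \<in> carrier_mat n n" for s by (simp add: X_def)
  have XP: "P $$ (i, j) = (\<Sum>s\<in>V. h (X s $$ (i, j)) * s)" if "i < n" "j < n" for i j
    using that r by (simp add: X_def)
  have "B * X s = X s * A" if s: "s \<in> V" for s
  proof (rule eq_matI)
    fix i j assume "i < dim_row (X s * A)" "j < dim_col (X s * A)"
    then have ij: "i < n" "j < n" using A X[of s] by auto
    have "(\<Sum>s\<in>V. h ((B * X s) $$ (i, j)) * s) = (map_mat h B * P) $$ (i, j)"
    proof -
      have "(map_mat h B * P) $$ (i, j) = (\<Sum>k<n. h (B $$ (i, k)) * P $$ (k, j))"
        using ij B P by (simp add: scalar_prod_def atLeast0LessThan)
      also have "\<dots> = (\<Sum>k<n. \<Sum>s\<in>V. h (B $$ (i, k) * X s $$ (k, j)) * s)"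
        by (intro sum.cong refl) (simp add: XP ij sum_distrib_left hom_mult mult.assoc)
      also have "\<dots> = (\<Sum>s\<in>V. h ((B * X s) $$ (i, j)) * s)"
        by (subst sum.swap) (simp add: index_mult_mat_sum[OF B X ij] hom_sum sum_distrib_right)
      finally show ?thesis by simp
    qed
    moreover have "(\<Sum>s\<in>V. h ((X s * A) $$ (i, j)) * s) = (P * map_mat h A) $$ (i, j)"
    proof -
      have "(P * map_mat h A) $$ (i, j) = (\<Sum>k<n. P $$ (i, k) * h (A $$ (k, j)))"
        using ij A P by (simp add: scalar_prod_def atLeast0LessThan)
      also have "\<dots> = (\<Sum>k<n. \<Sum>s\<in>V. h (X s $$ (i, k) * A $$ (k, j)) * s)"
        by (intro sum.cong refl) (subst XP[OF ij(1)], auto simp: sum_distrib_right hom_mult intro!: sum.cong)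
      also have "\<dots> = (\<Sum>s\<in>V. h ((X s * A) $$ (i, j)) * s)"
        by (subst sum.swap) (simp add: index_mult_mat_sum[OF X A ij] hom_sum sum_distrib_right)
      finally show ?thesis by simp
    qed
    ultimately have "(\<Sum>s\<in>V. h ((B * X s) $$ (i, j) - (X s * A) $$ (i, j)) * s) = 0"
      by (simp add: hom_minus left_diff_distrib sum_subtractf comm)
    then have "(B * X s) $$ (i, j) - (X s * A) $$ (i, j) = 0"
      using M.independentD[OF V(2) finV subset_refl, of "\<lambda>s. (B * X s) $$ (i, j) - (X s * A) $$ (i, j)" s] s
      by simp
    then show "(B * X s) $$ (i, j) = (X s * A) $$ (i, j)" by simp
  qed (use A B X[of s] in auto)
  with V(1) finV X XP show thesis by (intro that)
qed

text \<open>Expanding \<open>1 = Q * P\<close> gives a combination of products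
  \<open>Y t * X s\<close> with integral coefficients \<open>t * s\<close>. If all these products
  annihilated \<open>z\<close> over the residue field, every entry of a lift \<open>Z\<close> would
  be a combination of nonunits with integral coefficients, hence a nonunit; but \<open>z\<close> has
  a nonzero entry.\<close>

lemma ex_intertwiners_not_killing:
  fixes A B :: "'r mat"
  assumes A: "A \<in> carrier_mat n n" and B: "B \<in> carrier_mat n n"
    and P: "P \<in> carrier_mat n n" "elements_mat P \<subseteq> integral_closure h" "map_mat h B * P = P * map_mat h A"
    and Q: "Q \<in> carrier_mat n n" "elements_mat Q \<subseteq> integral_closure h" "map_mat h A * Q = Q * map_mat h B"
    and QP: "Q * P = 1\<^sub>m n"
  shows "\<exists>F. finite F \<and>
    (\<forall>(Y, X)\<in>F. Y \<in> carrier_mat n n \<and> X \<in> carrier_mat n n \<and> B * X = X * A \<and> A * Y = Y * B) \<and>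
    (\<forall>z\<in>carrier_mat n n. z \<noteq> 0\<^sub>m n n \<longrightarrow>
      (\<exists>(Y, X)\<in>F. map_mat residue (Y * X) * z \<noteq> 0\<^sub>m n n))"
proof -
  obtain V X where V: "finite V" "V \<subseteq> elements_mat P"
    and X: "\<And>s. s \<in> V \<Longrightarrow> X s \<in> carrier_mat n n" "\<And>s. s \<in> V \<Longrightarrow> B * X s = X s * A"
    and PX: "\<And>i j. i < n \<Longrightarrow> j < n \<Longrightarrow> P $$ (i, j) = (\<Sum>s\<in>V. h (X s $$ (i, j)) * s)"
    by (rule intertwiner_decomposition[OF P(1) A B P(3)]) (rule that, assumption+)
  obtain W Y where W: "finite W" "W \<subseteq> elements_mat Q"
    and Y: "\<And>s. s \<in> W \<Longrightarrow> Y s \<in> carrier_mat n n" "\<And>s. s \<in> W \<Longrightarrow> A * Y s = Y s * B"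
    and QY: "\<And>i j. i < n \<Longrightarrow> j < n \<Longrightarrow> Q $$ (i, j) = (\<Sum>s\<in>W. h (Y s $$ (i, j)) * s)"
    by (rule intertwiner_decomposition[OF Q(1) B A Q(3)]) (rule that, assumption+)
  have "\<exists>(t, s)\<in>W \<times> V. map_mat residue (Y t * X s) * z \<noteq> 0\<^sub>m n n"
    if z: "z \<in> carrier_mat n n" "z \<noteq> 0\<^sub>m n n" for z
  proof (rule ccontr)
    assume "\<not> ?thesis"
    then have kill: "map_mat residue (Y t * X s) * z = 0\<^sub>m n n" if "t \<in> W" "s \<in> V" for s t
      using that by auto
    obtain a b where ab: "a < n" "b < n" "z $$ (a, b) \<noteq> 0"
      using z by (metis carrier_matD eq_matI index_zero_mat)
    \<comment> \<open>A set-theoretic section of the residue map, applied entrywise to lift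
      \<open>z\<close>.\<close>
    obtain l :: "'r residue_field \<Rightarrow> 'r" where l: "\<And>x. residue (l x) = x" using surj_residue by (metis surjD)
    define Z where "Z = map_mat l z"
    have Z: "Z \<in> carrier_mat n n" and zZ: "z = map_mat residue Z"
      using z(1) by (auto simp: Z_def l)
    define m where "m = (\<lambda>(t, s). (Y t * X s * Z) $$ (a, b))"
    have nonunit: "\<not> m x dvd 1" if x: "x \<in> W \<times> V" for x
    proof -
      obtain t s where ts: "x = (t, s)" "t \<in> W" "s \<in> V" using x by auto
      have "map_mat residue (Y t * X s * Z) = 0\<^sub>m n n"
        using kill[OF ts(2,3)] X(1)[OF ts(3)] Y(1)[OF ts(2)] Z
        by (subst residue.mat_hom_mult[of _ n n _ n]) (auto simp: zZ)
      then have "residue (m x) = 0"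
        using ab X(1)[OF ts(3)] Y(1)[OF ts(2)] Z unfolding m_def ts
        by (metis (no_types, lifting) case_prod_conv carrier_matD index_map_mat(1) index_mult_mat(2,3) index_zero_mat(1))
      then show ?thesis by (simp add: residue_eq_0_iff)
    qed
    have sum_eq: "(\<Sum>x\<in>W \<times> V. h (m x) * (fst x * snd x)) = h (Z $$ (a, b))"
    proof -
      \<comment> \<open>The expansion of \<open>1 = Q * P\<close> in the two bases, entry by
        entry.\<close>
      have one: "(\<Sum>(t, s)\<in>W \<times> V. h ((Y t * X s) $$ (i, j)) * (t * s)) = (1\<^sub>m n :: 'l mat) $$ (i, j)"
        if ij: "i < n" "j < n" for i j
      proof -
        have "(1\<^sub>m n :: 'l mat) $$ (i, j) = (\<Sum>k<n. Q $$ (i, k) * P $$ (k, j))"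
          unfolding QP[symmetric] using P Q ij by (simp add: scalar_prod_def atLeast0LessThan)
        also have "\<dots> = (\<Sum>k<n. \<Sum>(t, s)\<in>W \<times> V. h (Y t $$ (i, k) * X s $$ (k, j)) * (t * s))"
          by (intro sum.cong refl)
            (auto simp: PX QY ij sum_product sum.cartesian_product hom_mult intro!: sum.cong)
        also have "\<dots> = (\<Sum>(t, s)\<in>W \<times> V. h ((Y t * X s) $$ (i, j)) * (t * s))"
          by (subst sum.swap, intro sum.cong refl)
            (auto simp: index_mult_mat_sum[OF Y(1) X(1) ij] hom_sum sum_distrib_right)
        finally show ?thesis by simp
      qed
      have "h (Z $$ (a, b)) = (\<Sum>k<n. (1\<^sub>m n :: 'l mat) $$ (a, k) * h (Z $$ (k, b)))"
        using ab by (simp add: if_distrib[of "\<lambda>x. x * _"] cong: if_cong)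
      also have "\<dots> = (\<Sum>k<n. \<Sum>(t, s)\<in>W \<times> V. h ((Y t * X s) $$ (a, k) * Z $$ (k, b)) * (t * s))"
        by (rule sum.cong[OF refl], subst one[OF ab(1), symmetric])
          (auto simp: sum_distrib_right hom_mult intro!: sum.cong)
      also have "\<dots> = (\<Sum>x\<in>W \<times> V. h (m x) * (fst x * snd x))"
      proof (subst sum.swap, intro sum.cong refl, clarsimp)
        fix t s assume ts: "t \<in> W" "s \<in> V"
        have "m (t, s) = (\<Sum>k<n. (Y t * X s) $$ (a, k) * Z $$ (k, b))"
          unfolding m_def prod.case
          by (rule index_mult_mat_sum[OF mult_carrier_mat[OF Y(1)[OF ts(1)] X(1)[OF ts(2)]] Z ab(1,2)])
        then show "(\<Sum>k<n. h ((Y t * X s) $$ (a, k) * Z $$ (k, b)) * (t * s)) = h (m (t, s)) * (t * s)"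
          by (simp add: hom_sum sum_distrib_right)
      qed
      finally show ?thesis by simp
    qed
    have prods: "\<exists>s\<in>W \<union> V. \<exists>t\<in>W \<union> V. fst x * snd x = s * t" if "x \<in> W \<times> V" for x
      using that by (metis Un_iff mem_Times_iff)
    have "finite (W \<union> V)" "W \<union> V \<subseteq> integral_closure h"
      using V W P(2) Q(2) by (simp, blast)
    then have "\<not> Z $$ (a, b) dvd 1"
      by (rule nonunit_if_nonunit_combination[OF _ _ prods nonunit sum_eq])
    then show False using ab z(1) Z by (auto simp: zZ residue_eq_0_iff)
  qed
  then have faithful: "\<exists>(Y, X)\<in>(\<lambda>(t, s). (Y t, X s)) ` (W \<times> V). map_mat residue (Y * X) * z \<noteq> 0\<^sub>m n n"
    if "z \<in> carrier_mat n n" "z \<noteq> 0\<^sub>m n n" for z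
    using that by (simp add: image_iff split_beta Bex_def) metis
  show ?thesis
  proof (intro exI conjI ballI impI)
    show "finite ((\<lambda>(t, s). (Y t, X s)) ` (W \<times> V))" using V(1) W(1) by simp
    show "case p of (Y, X) \<Rightarrow> Y \<in> carrier_mat n n \<and> X \<in> carrier_mat n n \<and> B * X = X * A \<and> A * Y = Y * B"
      if "p \<in> (\<lambda>(t, s). (Y t, X s)) ` (W \<times> V)" for p
      using that X Y by auto
  qed (rule faithful)
qed

end

subsection \<open>Commutative matrix algebras over a field\<close>

text \<open>The matrices of size \<open>n\<close> form a space of dimension \<open>n * n\<close>, so
  \<open>n * n + 1\<close> of them are dependent. A family rather than a set allows repetitions, as
  may occur among the powers of a matrix.\<close>

lemma ex_linear_relation_mat:
  fixes F :: "nat \<Rightarrow> 'k::field mat"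
  obtains c where "\<exists>l\<le>n * n. c l \<noteq> 0"
    "\<And>i j. i < n \<Longrightarrow> j < n \<Longrightarrow> (\<Sum>l\<le>n * n. c l * F l $$ (i, j)) = 0"
proof -
  let ?N = "n * n"
  \<comment> \<open>Column \<open>l\<close> lists the entries of \<open>F l\<close>, with entry
    \<open>(i, j)\<close> in row \<open>i * n + j\<close>. The zero row at the end makes
    \<open>M\<close> square and singular.\<close>
  define M where "M = mat (Suc ?N) (Suc ?N) (\<lambda>(r, l). if r < ?N then F l $$ (r div n, r mod n) else 0)"
  have M: "M \<in> carrier_mat (Suc ?N) (Suc ?N)" by (simp add: M_def)
  have "det M = (\<Sum>j<Suc ?N. M $$ (?N, j) * cofactor M ?N j)"
    by (rule laplace_expansion_row[OF M]) simp
  also have "\<dots> = 0" by (intro sum.neutral) (simp add: M_def)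
  finally obtain v where v: "v \<in> carrier_vec (Suc ?N)" "v \<noteq> 0\<^sub>v (Suc ?N)" "M *\<^sub>v v = 0\<^sub>v (Suc ?N)"
    using det_0_iff_vec_prod_zero_field[OF M] by blast
  show thesis
  proof
    show "\<exists>l\<le>?N. v $ l \<noteq> 0"
    proof (rule ccontr)
      assume "\<not> ?thesis"
      then have "v = 0\<^sub>v (Suc ?N)" using v(1) by (intro eq_vecI) auto
      with v(2) show False ..
    qed
    fix i j assume ij: "i < n" "j < n"
    then have "i * n + j < Suc i * n" by simp
    also have "\<dots> \<le> n * n" using ij by (intro mult_le_mono) auto
    finally have r: "i * n + j < ?N" .
    have "(i * n + j) div n = i" "(i * n + j) mod n = j" using ij by auto
    then have "(M *\<^sub>v v) $ (i * n + j) = (\<Sum>l<Suc ?N. F l $$ (i, j) * v $ l)"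
      using r v(1) M by (simp add: scalar_prod_def M_def atLeast0LessThan del: sum.lessThan_Suc)
    then show "(\<Sum>l\<le>?N. v $ l * F l $$ (i, j)) = 0"
      using v(3) r by (simp add: lessThan_Suc_atMost mult.commute)
  qed
qed

section \<open>Powers, idempotents and nilpotents in a commutative matrix algebra\<close>

locale comm_mat_algebra =
  fixes n :: nat and C :: "'k::field mat set"
  assumes carrier: "x \<in> C \<Longrightarrow> x \<in> carrier_mat n n"
    and one [simp]: "1\<^sub>m n \<in> C"
    and add [simp]: "x \<in> C \<Longrightarrow> y \<in> C \<Longrightarrow> x + y \<in> C"
    and mult [simp]: "x \<in> C \<Longrightarrow> y \<in> C \<Longrightarrow> x * y \<in> C"
    and smult [simp]: "x \<in> C \<Longrightarrow> a \<cdot>\<^sub>m x \<in> C"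
    and comm: "x \<in> C \<Longrightarrow> y \<in> C \<Longrightarrow> x * y = y * x"
begin

lemma dim [simp]: "x \<in> C \<Longrightarrow> dim_row x = n" "x \<in> C \<Longrightarrow> dim_col x = n"
  by (auto dest: carrier)

lemma zero [simp]: "0\<^sub>m n n \<in> C"
proof -
  have "0\<^sub>m n n = 0 \<cdot>\<^sub>m (1\<^sub>m n :: 'k mat)" by auto
  then show ?thesis by simp
qed

lemma minus [simp]:
  assumes "x \<in> C" "y \<in> C"
  shows "x - y \<in> C"
proof -
  have "x - y = x + (-1) \<cdot>\<^sub>m y" using assms[THEN carrier] by auto
  with assms show ?thesis by simp
qed

lemma assoc: "x \<in> C \<Longrightarrow> y \<in> C \<Longrightarrow> z \<in> C \<Longrightarrow> x * y * z = x * (y * z)"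
  by (rule assoc_mult_mat[of _ n n _ n _ n]) (auto intro: carrier)

lemma left_comm: "x \<in> C \<Longrightarrow> y \<in> C \<Longrightarrow> z \<in> C \<Longrightarrow> x * (y * z) = y * (x * z)"
  by (metis assoc comm)

lemma mult_one [simp]: "x \<in> C \<Longrightarrow> x * 1\<^sub>m n = x" "x \<in> C \<Longrightarrow> 1\<^sub>m n * x = x"
  by (auto dest: carrier)

lemma mult_zero [simp]: "x \<in> C \<Longrightarrow> x * 0\<^sub>m n n = 0\<^sub>m n n" "x \<in> C \<Longrightarrow> 0\<^sub>m n n * x = 0\<^sub>m n n"
  by (auto dest: carrier)

lemma pow_0 [simp]: "x \<in> C \<Longrightarrow> x ^\<^sub>m 0 = 1\<^sub>m n"
  using carrier by auto

lemma pow [simp]: "x \<in> C \<Longrightarrow> x ^\<^sub>m k \<in> C"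
  by (induction k) auto

lemma pow_add: "x \<in> C \<Longrightarrow> x ^\<^sub>m (k + m) = x ^\<^sub>m k * x ^\<^sub>m m"
  by (induction m) (auto simp: assoc)

text \<open>The value at \<open>b\<close> of the polynomial with coefficients \<open>cs\<close>,
  constant term first. In this form a vanishing constant term is absorbed into a power of
  \<open>b\<close> standing in front.\<close>

primrec horner :: "'k mat \<Rightarrow> 'k list \<Rightarrow> 'k mat" where
  "horner b [] = 0\<^sub>m n n"
| "horner b (c # cs) = c \<cdot>\<^sub>m 1\<^sub>m n + b * horner b cs"

lemma horner [simp]: "b \<in> C \<Longrightarrow> horner b cs \<in> C"
  by (induction cs) auto

lemma pow_mult_horner_Cons:
  assumes "b \<in> C"
  shows "b ^\<^sub>m m * horner b (c # cs) = c \<cdot>\<^sub>m b ^\<^sub>m m + b ^\<^sub>m Suc m * horner b cs"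
proof -
  have "b ^\<^sub>m m * horner b (c # cs) = b ^\<^sub>m m * (c \<cdot>\<^sub>m 1\<^sub>m n) + b ^\<^sub>m m * (b * horner b cs)"
    unfolding horner.simps by (rule mult_add_distrib_mat[of _ n n _ n]) (intro carrier assms smult one mult horner pow)+
  also have "b ^\<^sub>m m * (c \<cdot>\<^sub>m 1\<^sub>m n) = c \<cdot>\<^sub>m (b ^\<^sub>m m * 1\<^sub>m n)"
    by (rule mult_smult_distrib[of _ n n _ n]) (intro carrier assms one pow)+
  finally show ?thesis using assms by (simp add: assoc)
qed

lemma index_pow_mult_horner:
  assumes b: "b \<in> C" and ij: "i < n" "j < n"
  shows "(b ^\<^sub>m m * horner b cs) $$ (i, j) = (\<Sum>l<length cs. cs ! l * (b ^\<^sub>m (m + l)) $$ (i, j))"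
proof (induction cs arbitrary: m)
  case Nil
  then show ?case using b ij by simp
next
  case (Cons c cs)
  have "b ^\<^sub>m m \<in> carrier_mat n n" "b ^\<^sub>m Suc m * horner b cs \<in> carrier_mat n n"
    using b by (auto simp del: pow_mat.simps intro!: carrier)
  then have "(b ^\<^sub>m m * horner b (c # cs)) $$ (i, j)
      = c * (b ^\<^sub>m m) $$ (i, j) + (b ^\<^sub>m Suc m * horner b cs) $$ (i, j)"
    unfolding pow_mult_horner_Cons[OF b] using ij b by (simp del: pow_mat.simps)
  then show ?case unfolding Cons.IH by (simp add: sum.lessThan_Suc_shift del: pow_mat.simps sum.lessThan_Suc)
qed

text \<open>At the lowest nonzero coefficient \<open>c\<close> the relation reads
  \<open>c b^m + b^(m+1) q(b) = 0\<close> and can be solved for \<open>b^m\<close>. The zero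
  coefficients before it only raise \<open>m\<close>.\<close>

lemma stabilising_power_if_horner_eq_0:
  assumes b: "b \<in> C"
  shows "b ^\<^sub>m m * horner b cs = 0\<^sub>m n n \<Longrightarrow> \<exists>c\<in>set cs. c \<noteq> 0 \<Longrightarrow> \<exists>r. \<exists>h\<in>C. b ^\<^sub>m r = b ^\<^sub>m Suc r * h"
proof (induction cs arbitrary: m)
  case (Cons c cs)
  let ?H = "b ^\<^sub>m Suc m * horner b cs"
  have carr: "b ^\<^sub>m m \<in> carrier_mat n n" "?H \<in> carrier_mat n n"
    using b by (auto simp del: pow_mat.simps intro!: carrier)
  have eq: "c \<cdot>\<^sub>m b ^\<^sub>m m + ?H = 0\<^sub>m n n"
    using Cons.prems(1) unfolding pow_mult_horner_Cons[OF b] .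
  show ?case
  proof (cases "c = 0")
    case True
    then have "c \<cdot>\<^sub>m b ^\<^sub>m m = 0\<^sub>m n n" using b by (intro eq_matI) auto
    then have "?H = 0\<^sub>m n n" using eq carr(2) by (simp del: pow_mat.simps)
    moreover have "\<exists>c\<in>set cs. c \<noteq> 0" using Cons.prems(2) True by auto
    ultimately show ?thesis by (rule Cons.IH)
  next
    case False
    have "b ^\<^sub>m m = (- inverse c) \<cdot>\<^sub>m ?H"
    proof (rule eq_matI)
      fix i j assume "i < dim_row ((- inverse c) \<cdot>\<^sub>m ?H)" "j < dim_col ((- inverse c) \<cdot>\<^sub>m ?H)"
      then have ij: "i < n" "j < n" using carr(2) by auto
      have "(c \<cdot>\<^sub>m b ^\<^sub>m m + ?H) $$ (i, j) = 0" unfolding eq using ij by simp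
      then have "c * (b ^\<^sub>m m) $$ (i, j) + ?H $$ (i, j) = 0"
        using b ij by (simp del: pow_mat.simps)
      then show "(b ^\<^sub>m m) $$ (i, j) = ((- inverse c) \<cdot>\<^sub>m ?H) $$ (i, j)"
        using False b ij by (simp add: field_simps add_eq_0_iff del: pow_mat.simps)
    qed (use b in \<open>auto simp del: pow_mat.simps\<close>)
    also have "\<dots> = b ^\<^sub>m Suc m * ((- inverse c) \<cdot>\<^sub>m horner b cs)"
      by (rule mult_smult_distrib[symmetric]) (use b in \<open>auto simp del: pow_mat.simps intro!: carrier\<close>)
    finally have "b ^\<^sub>m m = b ^\<^sub>m Suc m * ((- inverse c) \<cdot>\<^sub>m horner b cs)" .
    then show ?thesis using smult[OF horner[OF b]] by blast
  qed
qed simp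

lemma ex_stabilising_power:
  assumes b: "b \<in> C"
  shows "\<exists>r. \<exists>h\<in>C. b ^\<^sub>m r = b ^\<^sub>m Suc r * h"
proof -
  obtain c where c: "\<exists>l\<le>n * n. c l \<noteq> 0"
    and rel: "\<And>i j. i < n \<Longrightarrow> j < n \<Longrightarrow> (\<Sum>l\<le>n * n. c l * (b ^\<^sub>m l) $$ (i, j)) = 0"
    by (rule ex_linear_relation_mat[of n "\<lambda>l. b ^\<^sub>m l"]) (rule that, assumption+)
  define cs where "cs = map c [0..<Suc (n * n)]"
  have "b ^\<^sub>m 0 * horner b cs = 0\<^sub>m n n"
  proof (rule eq_matI)
    fix i j assume "i < dim_row (0\<^sub>m n n :: 'k mat)" "j < dim_col (0\<^sub>m n n :: 'k mat)"
    then have ij: "i < n" "j < n" by auto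
    have "(\<Sum>l<length cs. cs ! l * (b ^\<^sub>m (0 + l)) $$ (i, j)) = (\<Sum>l\<le>n * n. c l * (b ^\<^sub>m l) $$ (i, j))"
      by (intro sum.cong) (auto simp: cs_def simp del: upt_Suc)
    then show "(b ^\<^sub>m 0 * horner b cs) $$ (i, j) = (0\<^sub>m n n :: 'k mat) $$ (i, j)"
      unfolding index_pow_mult_horner[OF b ij] using rel[OF ij] ij by simp
  qed (use b in auto)
  moreover have "\<exists>c\<in>set cs. c \<noteq> 0"
  proof -
    from c obtain l where l: "l \<le> n * n" "c l \<noteq> 0" by blast
    then have "c l \<in> set cs" unfolding cs_def set_map set_upt by (intro imageI) simp
    with l show ?thesis by blast
  qed
  ultimately show ?thesis by (rule stabilising_power_if_horner_eq_0[OF b])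
qed

text \<open>A form of Fitting's lemma. Iterating the stabilisation yields
  \<open>p = p * p * (b * h')\<close> for a power \<open>p\<close> of \<open>b\<close>, so
  \<open>p * (b * h')\<close> is idempotent. It is nonzero because multiplication by it fixes
  \<open>p\<close>, which is nonzero.\<close>

lemma ex_idempotent_multiple:
  assumes b: "b \<in> C" and nonnil: "\<And>r. b ^\<^sub>m r \<noteq> 0\<^sub>m n n"
  shows "\<exists>g\<in>C. b * g * (b * g) = b * g \<and> b * g \<noteq> 0\<^sub>m n n"
proof -
  obtain r h where h: "h \<in> C" and r: "b ^\<^sub>m r = b ^\<^sub>m Suc r * h"
    using ex_stabilising_power[OF b] by blast
  have "\<exists>h\<in>C. b ^\<^sub>m r = b ^\<^sub>m (r + m) * h" for m
  proof (induction m)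
    case 0
    show ?case using b by (intro bexI[of _ "1\<^sub>m n"]) auto
  next
    case (Suc m)
    then obtain h' where h': "h' \<in> C" "b ^\<^sub>m r = b ^\<^sub>m (r + m) * h'" by blast
    note h'(2)
    also have "b ^\<^sub>m (r + m) = b ^\<^sub>m Suc r * h * b ^\<^sub>m m"
      unfolding pow_add[OF b] by (simp only: r)
    also have "\<dots> * h' = b ^\<^sub>m (r + Suc m) * (h * h')"
      using b h h'(1) by (simp add: pow_add assoc left_comm comm)
    finally show ?case using h h'(1) by auto
  qed
  \<comment> \<open>The total exponent is \<open>2 * (r + 1)\<close>, so that the square of
    \<open>p = b^(r+1)\<close> appears.\<close>
  from this[of "Suc (Suc r)"] obtain h' where h': "h' \<in> C" "b ^\<^sub>m r = b ^\<^sub>m (r + Suc (Suc r)) * h'" by blast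
  define p where "p = b ^\<^sub>m Suc r"
  have p: "p \<in> C" using b unfolding p_def by (rule pow)
  have pb: "p = b * b ^\<^sub>m r" using b by (simp add: p_def comm)
  have "p * (p * h') = b ^\<^sub>m r"
  proof -
    have "b ^\<^sub>m (r + Suc (Suc r)) = p * p"
      unfolding p_def pow_add[OF b, symmetric] by (rule arg_cong[of _ _ "\<lambda>k. b ^\<^sub>m k"]) simp
    then show ?thesis using h' p by (simp add: assoc)
  qed
  then have pp: "p * (p * (b * h')) = p"
    unfolding pb using b h'(1) p by (metis (no_types, lifting) assoc left_comm mult pow comm)
  define g where "g = b ^\<^sub>m r * (b * h')"
  have g: "g \<in> C" using b h' by (simp add: g_def)
  have bg: "b * g = p * (b * h')" using b h' by (simp add: g_def pb assoc)
  have "b * g * (b * g) = p * (b * h') * (p * (b * h'))" by (simp only: bg)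
  also have "\<dots> = p * (p * (b * h')) * (b * h')" using p b h'(1) by (simp add: assoc left_comm comm)
  finally have "b * g * (b * g) = b * g" by (simp only: pp bg)
  moreover have "b * g \<noteq> 0\<^sub>m n n"
  proof
    assume "b * g = 0\<^sub>m n n"
    then have "p * (p * (b * h')) = 0\<^sub>m n n" using p by (simp add: bg)
    then have "p = 0\<^sub>m n n" using pp by simp
    then show False using nonnil[of "Suc r"] unfolding p_def by blast
  qed
  ultimately show ?thesis using g by blast
qed

text \<open>Stands in for the fact that an ideal generated by nilpotent elements contains no nonzero
  idempotent.\<close>

lemma ex_annihilated_multiple:
  assumes "finite T" "T \<subseteq> C" "\<And>b. b \<in> T \<Longrightarrow> \<exists>r. b ^\<^sub>m r = 0\<^sub>m n n"
    and z: "z \<in> C" "z \<noteq> 0\<^sub>m n n"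
  shows "\<exists>w\<in>C. z * w \<noteq> 0\<^sub>m n n \<and> (\<forall>b\<in>T. b * (z * w) = 0\<^sub>m n n)"
  using assms(1-3)
proof (induction T rule: finite_induct)
  case empty
  show ?case using z by (intro bexI[of _ "1\<^sub>m n"]) auto
next
  case (insert b T)
  then obtain w where w: "w \<in> C" "z * w \<noteq> 0\<^sub>m n n" "\<And>t. t \<in> T \<Longrightarrow> t * (z * w) = 0\<^sub>m n n"
    by auto
  have b: "b \<in> C" using insert.prems(1) by simp
  \<comment> \<open>As \<open>z * w\<close> is nonzero, \<open>r\<close> is positive. By minimality
    \<open>b^(r-1) * (z * w)\<close> is nonzero, and \<open>b\<close> kills it; by commutativity so
    do the elements treated before.\<close>
  define r where "r = (LEAST r. b ^\<^sub>m r * (z * w) = 0\<^sub>m n n)"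
  obtain R where "b ^\<^sub>m R = 0\<^sub>m n n" using insert.prems(2)[of b] by blast
  then have "b ^\<^sub>m R * (z * w) = 0\<^sub>m n n" using z(1) w(1) by simp
  then have "\<exists>r. b ^\<^sub>m r * (z * w) = 0\<^sub>m n n" by blast
  then have r: "b ^\<^sub>m r * (z * w) = 0\<^sub>m n n" unfolding r_def by (rule LeastI_ex)
  have "r \<noteq> 0" using r w z(1) b by (intro notI) simp
  then obtain s where s: "r = Suc s" by (cases r) auto
  have "b ^\<^sub>m s * (z * w) \<noteq> 0\<^sub>m n n"
    using not_less_Least[of s "\<lambda>r. b ^\<^sub>m r * (z * w) = 0\<^sub>m n n"] s unfolding r_def by auto
  then have "z * (b ^\<^sub>m s * w) \<noteq> 0\<^sub>m n n" using b w(1) z(1) by (simp add: left_comm)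
  moreover have "b * (z * (b ^\<^sub>m s * w)) = 0\<^sub>m n n"
    using r b w(1) z(1) by (simp add: s assoc left_comm)
  moreover have "t * (z * (b ^\<^sub>m s * w)) = 0\<^sub>m n n" if "t \<in> T" for t
  proof -
    have "t \<in> C" using that insert.prems(1) by auto
    then have "t * (z * (b ^\<^sub>m s * w)) = b ^\<^sub>m s * (t * (z * w))"
      using b w(1) z(1) by (simp add: left_comm)
    then show ?thesis using w(3)[OF that] b by simp
  qed
  ultimately show ?case using b w(1) by (intro bexI[of _ "b ^\<^sub>m s * w"]) auto
qed

text \<open>Multiplying a linear relation by \<open>F k\<close> leaves only
  \<open>c k * F k\<close>, so the idempotents are linearly independent. This bounds how often an
  idempotent can be enlarged in \<open>ex_invertible\<close>.\<close>

lemma card_orthogonal_idempotents: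
  assumes F: "\<And>i. i < m \<Longrightarrow> F i \<in> C" "\<And>i. i < m \<Longrightarrow> F i \<noteq> 0\<^sub>m n n" "\<And>i. i < m \<Longrightarrow> F i * F i = F i"
    and orth: "\<And>i j. i < m \<Longrightarrow> j < m \<Longrightarrow> i \<noteq> j \<Longrightarrow> F i * F j = 0\<^sub>m n n"
  shows "m \<le> n * n"
proof (rule ccontr)
  assume "\<not> ?thesis"
  then have m: "l < m" if "l \<le> n * n" for l using that by simp
  obtain c where c: "\<exists>l\<le>n * n. c l \<noteq> 0"
    and rel: "\<And>i j. i < n \<Longrightarrow> j < n \<Longrightarrow> (\<Sum>l\<le>n * n. c l * F l $$ (i, j)) = 0"
    by (rule ex_linear_relation_mat[of n F]) (rule that, assumption+)
  from c obtain k where k: "k \<le> n * n" "c k \<noteq> 0" by blast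
  have "F k = 0\<^sub>m n n"
  proof (rule eq_matI)
    fix i j assume "i < dim_row (0\<^sub>m n n :: 'k mat)" "j < dim_col (0\<^sub>m n n :: 'k mat)"
    then have ij: "i < n" "j < n" by auto
    have "0 = (\<Sum>a<n. (\<Sum>l\<le>n * n. c l * F l $$ (i, a)) * F k $$ (a, j))"
      using rel ij by simp
    also have "\<dots> = (\<Sum>l\<le>n * n. c l * (F l * F k) $$ (i, j))"
    proof -
      have "(F l * F k) $$ (i, j) = (\<Sum>a<n. F l $$ (i, a) * F k $$ (a, j))" if "l \<le> n * n" for l
        by (rule index_mult_mat_sum[OF carrier[OF F(1)[OF m[OF that]]] carrier[OF F(1)[OF m[OF k(1)]]] ij])
      then have "(\<Sum>l\<le>n * n. c l * (F l * F k) $$ (i, j))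
          = (\<Sum>l\<le>n * n. \<Sum>a<n. c l * F l $$ (i, a) * F k $$ (a, j))"
        by (intro sum.cong refl) (simp add: sum_distrib_left mult.assoc)
      then show ?thesis by (subst (asm) sum.swap) (simp add: sum_distrib_right)
    qed
    also have "\<dots> = (\<Sum>l\<le>n * n. if l = k then c k * F k $$ (i, j) else 0)"
      using F(3) orth m k(1) ij by (intro sum.cong refl) auto
    also have "\<dots> = c k * F k $$ (i, j)" using k(1) by simp
    finally show "F k $$ (i, j) = (0\<^sub>m n n :: 'k mat) $$ (i, j)" using k(2) ij by simp
  qed (use carrier[OF F(1)[OF m[OF k(1)]]] in auto)
  with F(2)[OF m[OF k(1)]] show False ..
qed

end

text \<open>The last assumption is a form of saying that the products \<open>Y * X\<close> with \<open>(Y, X) \<in> T\<close>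
  generate the unit ideal of \<open>C\<close> that is easy to verify by base change.\<close>

locale mat_morita_context = comm_mat_algebra n C for n and C :: "'k::field mat set" +
  fixes W W' :: "'k mat set" and T :: "('k mat \<times> 'k mat) set"
  assumes W_carrier: "X \<in> W \<Longrightarrow> X \<in> carrier_mat n n" and W'_carrier: "Y \<in> W' \<Longrightarrow> Y \<in> carrier_mat n n"
    and W_zero: "0\<^sub>m n n \<in> W" and W'_zero: "0\<^sub>m n n \<in> W'"
    and W_add: "X \<in> W \<Longrightarrow> X' \<in> W \<Longrightarrow> X + X' \<in> W" and W'_add: "Y \<in> W' \<Longrightarrow> Y' \<in> W' \<Longrightarrow> Y + Y' \<in> W'"
    and W_mult: "X \<in> W \<Longrightarrow> c \<in> C \<Longrightarrow> X * c \<in> W" and W'_mult: "Y \<in> W' \<Longrightarrow> c \<in> C \<Longrightarrow> c * Y \<in> W'"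
    and pairing: "Y \<in> W' \<Longrightarrow> X \<in> W \<Longrightarrow> Y * X \<in> C"
    and T: "finite T" "T \<subseteq> W' \<times> W"
    and T_faithful: "z \<in> C \<Longrightarrow> z \<noteq> 0\<^sub>m n n \<Longrightarrow> \<exists>(Y, X)\<in>T. Y * X * z \<noteq> 0\<^sub>m n n"
begin

text \<open>If \<open>e = Y * X\<close> is an idempotent other than \<open>1\<close>, some \<open>b = (1 - e) * (Y\<^sub>1 * X\<^sub>1)\<close> is not nilpotent and has a
  nonzero idempotent multiple \<open>f = b * g\<close>, orthogonal to \<open>e\<close>. Then \<open>X' = X * e + X\<^sub>1 * (g * (1 - e))\<close> and
  \<open>Y' = e * Y + (1 - e) * Y\<^sub>1\<close> satisfy \<open>Y' * X' = e + f\<close>: commutativity of \<open>C\<close> kills the cross terms.\<close>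

lemma enlarge_idempotent:
  assumes X: "X \<in> W" and Y: "Y \<in> W'" and idem: "Y * X * (Y * X) = Y * X" and ne: "Y * X \<noteq> 1\<^sub>m n"
  shows "\<exists>X'\<in>W. \<exists>Y'\<in>W'. \<exists>f\<in>C. f \<noteq> 0\<^sub>m n n \<and> f * f = f \<and> Y * X * f = 0\<^sub>m n n \<and> Y' * X' = Y * X + f"
proof -
  define e where "e = Y * X"
  define d where "d = 1\<^sub>m n - e"
  have e: "e \<in> C" "e * e = e" using pairing[OF Y X] idem by (auto simp: e_def)
  have d: "d \<in> C" using e by (simp add: d_def)
  note ec = carrier[OF e(1)] and dc = carrier[OF d]
  have ed: "e * d = 0\<^sub>m n n"
    unfolding d_def using ec by (subst mult_minus_distrib_mat[of _ n n _ n]) (auto simp: e(2))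
  have dd: "d * d = d"
  proof -
    have "d * d = 1\<^sub>m n * d - e * d"
      using dc ec by (subst (1) d_def) (subst minus_mult_distrib_mat[of _ n n _ _ n], auto)
    then show ?thesis using dc by (auto simp: ed)
  qed
  have "d \<noteq> 0\<^sub>m n n"
  proof
    assume d0: "d = 0\<^sub>m n n"
    have "e = 1\<^sub>m n"
    proof (rule eq_matI)
      fix i j assume "i < dim_row (1\<^sub>m n :: 'k mat)" "j < dim_col (1\<^sub>m n :: 'k mat)"
      then have ij: "i < n" "j < n" by auto
      have "d $$ (i, j) = 0" unfolding d0 using ij by simp
      then show "e $$ (i, j) = (1\<^sub>m n :: 'k mat) $$ (i, j)" using ij ec by (simp add: d_def)
    qed (use ec in auto)
    with ne show False by (simp add: e_def)
  qed
  let ?T = "(\<lambda>(Y, X). d * (Y * X)) ` T"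
  \<comment> \<open>If all these products were nilpotent, they would annihilate some nonzero
    \<open>d * w\<close>. Since \<open>d * (d * w) = d * w\<close>, every \<open>Y * X\<close>
    coming from \<open>T\<close> would annihilate it too, against \<open>T_faithful\<close>.\<close>
  have "\<exists>b\<in>?T. \<forall>r. b ^\<^sub>m r \<noteq> 0\<^sub>m n n"
  proof (rule ccontr)
    assume "\<not> ?thesis"
    then have nil: "\<exists>r. b ^\<^sub>m r = 0\<^sub>m n n" if "b \<in> ?T" for b using that by blast
    have "?T \<subseteq> C" using T(2) d pairing by auto
    then obtain w where w: "w \<in> C" "d * w \<noteq> 0\<^sub>m n n" "\<forall>b\<in>?T. b * (d * w) = 0\<^sub>m n n"
      using ex_annihilated_multiple[OF finite_imageI[OF T(1)] _ nil d \<open>d \<noteq> 0\<^sub>m n n\<close>] by blast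
    obtain Y1 X1 where T1: "(Y1, X1) \<in> T" "Y1 * X1 * (d * w) \<noteq> 0\<^sub>m n n"
      using T_faithful[of "d * w"] w(1,2) d by auto
    have c: "Y1 * X1 \<in> C" using T1(1) T(2) pairing by auto
    have "d * (Y1 * X1) * (d * w) = Y1 * X1 * (d * (d * w))"
      unfolding assoc[OF d c mult[OF d w(1)]] by (rule left_comm[OF d c mult[OF d w(1)]])
    also have "d * (d * w) = d * w" unfolding assoc[OF d d w(1), symmetric] dd ..
    finally show False using w(3) T1 by force
  qed
  then obtain Y1 X1 where T1: "(Y1, X1) \<in> T" "\<And>r. (d * (Y1 * X1)) ^\<^sub>m r \<noteq> 0\<^sub>m n n" by auto
  have W1: "X1 \<in> W" "Y1 \<in> W'" using T1(1) T(2) by auto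
  define b where "b = d * (Y1 * X1)"
  have b: "b \<in> C" using d pairing[OF W1(2,1)] by (simp add: b_def)
  obtain g where g: "g \<in> C" "b * g * (b * g) = b * g" "b * g \<noteq> 0\<^sub>m n n"
    using ex_idempotent_multiple[OF b] T1(2) unfolding b_def by blast
  have eb: "e * b = 0\<^sub>m n n"
    unfolding b_def using assoc[OF e(1) d pairing[OF W1(2,1)]] pairing[OF W1(2,1)] by (simp add: ed)
  have bd: "b * d = b"
    unfolding b_def using d pairing[OF W1(2,1)] by (metis assoc comm dd)
  define X' where "X' = X * e + X1 * (g * d)"
  define Y' where "Y' = e * Y + d * Y1"
  have "X' \<in> W" "Y' \<in> W'"
    using X Y W1 e d g by (auto simp: X'_def Y'_def intro!: W_add W'_add W_mult W'_mult)
  moreover have "Y' * X' = e + b * g"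
  proof -
    let ?f = "g * d"
    have f: "?f \<in> carrier_mat n n" using g(1) d by (intro carrier) simp
    note cs = W_carrier[OF X] W'_carrier[OF Y] W_carrier[OF W1(1)] W'_carrier[OF W1(2)] ec dc f
    have c: "Y * X1 \<in> C" "Y1 * X \<in> C" "Y1 * X1 \<in> C" using X Y W1 pairing by auto
    have "Y' * X' = (e * Y) * (X * e) + (e * Y) * (X1 * ?f) + ((d * Y1) * (X * e) + (d * Y1) * (X1 * ?f))"
    proof -
      have p: "e * Y \<in> carrier_mat n n" "d * Y1 \<in> carrier_mat n n"
        "X * e \<in> carrier_mat n n" "X1 * ?f \<in> carrier_mat n n"
        using cs by (auto intro: mult_carrier_mat)
      show ?thesis
        unfolding X'_def Y'_def add_mult_distrib_mat[OF p(1,2) add_carrier_mat[OF p(4)]]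
          mult_add_distrib_mat[OF p(1,3,4)] mult_add_distrib_mat[OF p(2,3,4)] ..
    qed
    also have "(e * Y) * (X * e) = e * ((Y * X) * e)"
      using cs by (simp add: assoc_mult_mat[of _ n n _ n _ n])
    also have "\<dots> = e" by (simp add: e_def[symmetric] e(2))
    also have "(e * Y) * (X1 * ?f) = e * ((Y * X1) * ?f)"
      using cs by (simp add: assoc_mult_mat[of _ n n _ n _ n])
    also have "\<dots> = (e * d) * ((Y * X1) * g)"
      using c e(1) d g(1) by (simp add: assoc left_comm comm)
    also have "\<dots> = 0\<^sub>m n n" using c g(1) by (simp add: ed)
    also have "(d * Y1) * (X * e) = d * ((Y1 * X) * e)"
      using cs by (simp add: assoc_mult_mat[of _ n n _ n _ n])
    also have "\<dots> = (e * d) * (Y1 * X)" using c e(1) d by (simp add: assoc left_comm comm)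
    also have "\<dots> = 0\<^sub>m n n" using c by (simp add: ed)
    also have "(d * Y1) * (X1 * ?f) = d * ((Y1 * X1) * ?f)"
      using cs by (simp add: assoc_mult_mat[of _ n n _ n _ n])
    also have "\<dots> = (b * d) * g" unfolding b_def using c(3) d g(1) by (simp add: assoc left_comm comm)
    also have "\<dots> = b * g" by (simp add: bd)
    finally show ?thesis using ec carrier[OF mult[OF b g(1)]] by simp
  qed
  moreover have "e * (b * g) = 0\<^sub>m n n" using assoc[OF e(1) b g(1)] g(1) by (simp add: eb)
  moreover have "b * g \<in> C" using b g(1) by simp
  ultimately show ?thesis using g(2,3) unfolding e_def by blast
qed

text \<open>Otherwise \<open>enlarge_idempotent\<close> can be repeated forever from
  \<open>X = Y = 0\<close>, giving more orthogonal idempotents than the dimension allows. The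
  invariant \<open>Y * X * F i = F i\<close> ensures that a new idempotent, orthogonal to
  \<open>Y * X\<close>, is orthogonal to all earlier ones.\<close>

lemma ex_invertible: "\<exists>X\<in>W. \<exists>Y\<in>W'. Y * X = 1\<^sub>m n"
proof (rule ccontr)
  assume none: "\<not> ?thesis"
  have "\<exists>X\<in>W. \<exists>Y\<in>W'. \<exists>F. Y * X * (Y * X) = Y * X \<and>
      (\<forall>i<m. F i \<in> C \<and> F i \<noteq> 0\<^sub>m n n \<and> F i * F i = F i \<and> Y * X * F i = F i) \<and>
      (\<forall>i<m. \<forall>j<m. i \<noteq> j \<longrightarrow> F i * F j = 0\<^sub>m n n)" for m :: nat
  proof (induction m)
    case 0
    show ?case using W_zero W'_zero
      by (intro bexI[of _ "0\<^sub>m n n"] exI[of _ "\<lambda>_. 0\<^sub>m n n"]) auto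
  next
    case (Suc m)
    then obtain X Y F where X: "X \<in> W" and Y: "Y \<in> W'" and idem: "Y * X * (Y * X) = Y * X"
      and "\<forall>i<m. F i \<in> C \<and> F i \<noteq> 0\<^sub>m n n \<and> F i * F i = F i \<and> Y * X * F i = F i"
      and "\<forall>i<m. \<forall>j<m. i \<noteq> j \<longrightarrow> F i * F j = 0\<^sub>m n n" by blast
    then have F: "\<And>i. i < m \<Longrightarrow> F i \<in> C \<and> F i \<noteq> 0\<^sub>m n n \<and> F i * F i = F i \<and> Y * X * F i = F i"
      and orth: "\<And>i j. i < m \<Longrightarrow> j < m \<Longrightarrow> i \<noteq> j \<Longrightarrow> F i * F j = 0\<^sub>m n n" by blast+
    have "Y * X \<noteq> 1\<^sub>m n" using none X Y by blast
    then obtain X' Y' f where X': "X' \<in> W" and Y': "Y' \<in> W'" and f: "f \<in> C" "f \<noteq> 0\<^sub>m n n" "f * f = f"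
      and ef: "Y * X * f = 0\<^sub>m n n" and sum: "Y' * X' = Y * X + f"
      using enlarge_idempotent[OF X Y idem] by blast
    define e where "e = Y * X"
    have e: "e \<in> C" using pairing[OF Y X] by (simp add: e_def)
    have fe: "f * e = 0\<^sub>m n n" "e * f = 0\<^sub>m n n" using ef comm[OF f(1) e] by (auto simp: e_def)
    have fF: "f * F i = 0\<^sub>m n n" if "i < m" for i
    proof -
      have "f * F i = f * e * F i" using F[OF that] f(1) e by (simp add: assoc e_def)
      then show ?thesis using F[OF that] by (simp add: fe)
    qed
    have distr: "(e + f) * x = e * x + f * x" if "x \<in> C" for x
      by (rule add_mult_distrib_mat) (use e f that in \<open>auto intro: carrier\<close>)
    have distl: "x * (e + f) = x * e + x * f" if "x \<in> C" for x
      by (rule mult_add_distrib_mat) (use e f that in \<open>auto intro: carrier\<close>)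
    note cs = carrier[OF e] carrier[OF f(1)]
    have "(e + f) * (e + f) = e + f"
      using e f idem cs by (simp add: distr distl fe e_def[symmetric])
    moreover have "(e + f) * F i = F i" if "i < m" for i
      using F[OF that] carrier[of "F i"] by (simp add: distr fF[OF that] e_def[symmetric])
    moreover have "(e + f) * f = f" using f cs by (simp add: distr fe)
    moreover have "F i * f = 0\<^sub>m n n" if "i < m" for i using fF[OF that] F[OF that] f(1) comm by metis
    ultimately show ?case
      using X' Y' F f orth fF
      by (intro bexI[of _ X'] bexI[of _ Y'] exI[of _ "F(m := f)"])
        (auto simp: sum e_def[symmetric] less_Suc_eq)
  qed
  from this[of "Suc (n * n)"] obtain F where
    F: "\<And>i. i < Suc (n * n) \<Longrightarrow> F i \<in> C" "\<And>i. i < Suc (n * n) \<Longrightarrow> F i \<noteq> 0\<^sub>m n n"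
      "\<And>i. i < Suc (n * n) \<Longrightarrow> F i * F i = F i"
      "\<And>i j. i < Suc (n * n) \<Longrightarrow> j < Suc (n * n) \<Longrightarrow> i \<noteq> j \<Longrightarrow> F i * F j = 0\<^sub>m n n"
    by blast
  from card_orthogonal_idempotents[of "Suc (n * n)" F, OF F] show False by simp
qed

end

subsection \<open>The commutant of a matrix with separable characteristic polynomial\<close>

text \<open>The Euclidean algorithm. The measure separates \<open>g = 0\<close> from the nonzero
  constants, which also have degree 0.\<close>

lemma coprime_imp_bezout_poly:
  fixes f g :: "'a::field poly"
  assumes "coprime f g"
  shows "\<exists>u v. u * f + v * g = 1"
  using assms
proof (induction "if g = 0 then 0 else Suc (degree g)" arbitrary: f g rule: less_induct)
  case less
  show ?case
  proof (cases "g = 0")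
    case True
    then have "f dvd 1" using less.prems by simp
    then show ?thesis by (metis True add.right_neutral dvdE mult.commute mult_zero_right)
  next
    case False
    have "coprime g (f mod g)"
    proof (rule coprimeI)
      fix c assume "c dvd g" "c dvd f mod g"
      moreover from this have "c dvd f" using dvd_mod_imp_dvd by blast
      ultimately show "is_unit c" using coprime_common_divisor[OF less.prems] by blast
    qed
    moreover have "(if f mod g = 0 then 0 else Suc (degree (f mod g))) < (if g = 0 then 0 else Suc (degree g))"
      using False degree_mod_less[of g f] by auto
    ultimately obtain u v where uv: "u * g + v * (f mod g) = 1" using less.hyps by blast
    have "v * f + (u - v * (f div g)) * g = u * g + v * (f - f div g * g)" by (simp add: algebra_simps)
    also have "\<dots> = 1" using uv by (simp add: minus_div_mult_eq_mod)
    finally show ?thesis by blast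
  qed
qed

text \<open>The Bezout identity \<open>u * f + v * pderiv f = 1\<close> is preserved by the
  homomorphism and excludes a common root in the larger field.\<close>

lemma separable_poly_no_multiple_root:
  fixes f :: "'a::field poly" and h :: "'a \<Rightarrow> 'b::field"
  assumes "comm_ring_hom h" "separable_poly f"
  shows "poly (map_poly h f) a \<noteq> 0 \<or> poly (pderiv (map_poly h f)) a \<noteq> 0"
proof -
  interpret h: comm_ring_hom h by fact
  interpret map_poly_h: map_poly_comm_ring_hom h ..
  have pderiv: "pderiv (map_poly h f) = map_poly h (pderiv f)"
  proof (rule poly_eqI)
    have "h (of_nat k) = of_nat k" for k by (induction k) (simp_all add: h.hom_add)
    then show "coeff (pderiv (map_poly h f)) k = coeff (map_poly h (pderiv f)) k" for k
      by (simp add: coeff_pderiv coeff_map_poly h.hom_mult h.hom_add)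
  qed
  obtain u v where "u * f + v * pderiv f = 1"
    using coprime_imp_bezout_poly assms(2) unfolding separable_poly_def by blast
  then have "map_poly h u * map_poly h f + map_poly h v * pderiv (map_poly h f) = 1"
    unfolding pderiv by (metis map_poly_h.hom_add map_poly_h.hom_mult map_poly_h.hom_one)
  then have "poly (map_poly h u * map_poly h f + map_poly h v * pderiv (map_poly h f)) a = 1" by simp
  then show ?thesis by auto
qed

text \<open>Comparing entries of \<open>Z * D = D * Z\<close> gives
  \<open>(d i - d j) * Z $$ (i, j) = 0\<close>. So a matrix commuting with \<open>D\<close> is
  diagonal, and diagonal matrices commute.\<close>

lemma commute_if_commute_with_diagonal:
  fixes D X Y :: "'a::idom mat"
  assumes D: "D \<in> carrier_mat n n" and diag: "\<And>i j. i < n \<Longrightarrow> j < n \<Longrightarrow> D $$ (i, j) = (if i = j then d i else 0)"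
    and inj: "inj_on d {..<n}"
    and X: "X \<in> carrier_mat n n" "X * D = D * X" and Y: "Y \<in> carrier_mat n n" "Y * D = D * Y"
  shows "X * Y = Y * X"
proof -
  have off: "Z $$ (i, j) = 0"
    if Z: "Z \<in> carrier_mat n n" "Z * D = D * Z" and ij: "i < n" "j < n" "i \<noteq> j" for Z i j
  proof -
    have "(Z * D) $$ (i, j) = (\<Sum>k<n. if k = j then Z $$ (i, j) * d j else 0)"
      unfolding index_mult_mat_sum[OF Z(1) D ij(1,2)] using ij by (intro sum.cong refl) (auto simp: diag)
    then have zd: "(Z * D) $$ (i, j) = Z $$ (i, j) * d j" using ij by simp
    have "(D * Z) $$ (i, j) = (\<Sum>k<n. if k = i then d i * Z $$ (i, j) else 0)"
      unfolding index_mult_mat_sum[OF D Z(1) ij(1,2)] using ij by (intro sum.cong refl) (auto simp: diag)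
    then have dz: "(D * Z) $$ (i, j) = d i * Z $$ (i, j)" using ij by simp
    have "(d i - d j) * Z $$ (i, j) = (D * Z) $$ (i, j) - (Z * D) $$ (i, j)"
      unfolding zd dz by (simp add: algebra_simps)
    then have "(d i - d j) * Z $$ (i, j) = 0" using Z(2) by simp
    moreover have "d i \<noteq> d j" using inj ij by (auto dest: inj_onD)
    ultimately show ?thesis by simp
  qed
  have prod: "(U * V) $$ (i, j) = (if i = j then U $$ (i, i) * V $$ (i, i) else 0)"
    if U: "U \<in> carrier_mat n n" "U * D = D * U" and V: "V \<in> carrier_mat n n" "V * D = D * V"
      and ij: "i < n" "j < n" for U V i j
  proof -
    have "(U * V) $$ (i, j) = (\<Sum>k<n. if k = i then U $$ (i, i) * V $$ (i, j) else 0)"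
      unfolding index_mult_mat_sum[OF U(1) V(1) ij] using ij off[OF U ij(1)]
      by (intro sum.cong refl) auto
    then show ?thesis using ij off[OF V ij] by auto
  qed
  show ?thesis
  proof (rule eq_matI)
    fix i j assume "i < dim_row (Y * X)" "j < dim_col (Y * X)"
    then have ij: "i < n" "j < n" using X Y by auto
    show "(X * Y) $$ (i, j) = (Y * X) $$ (i, j)"
      unfolding prod[OF X Y ij] prod[OF Y X ij] by (simp add: mult.commute)
  qed (use X Y in auto)
qed

text \<open>Applying \<open>A - a m\<close> to a relation ending in \<open>v m\<close> removes that
  term and multiplies the other coefficients by the nonzero factors \<open>a j - a m\<close>, which
  leaves a shorter relation.\<close>

lemma eigenvectors_independent:
  fixes A :: "'a::field mat" and c :: "nat \<Rightarrow> 'a"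
  assumes A: "A \<in> carrier_mat n n" and ev: "\<And>j. j < m \<Longrightarrow> eigenvector A (v j) (a j)"
    and inj: "inj_on a {..<m}"
    and rel: "\<And>i. i < n \<Longrightarrow> (\<Sum>j<m. c j * v j $ i) = 0" and j: "j < m"
  shows "c j = 0"
  using ev inj rel j
proof (induction m arbitrary: c j)
  case (Suc m)
  have v: "v j \<in> carrier_vec n" "v j \<noteq> 0\<^sub>v n" "A *\<^sub>v v j = a j \<cdot>\<^sub>v v j" if "j < Suc m" for j
    using Suc.prems(1)[OF that] A unfolding eigenvector_def by auto
  have Av: "(\<Sum>k<n. A $$ (i, k) * v j $ k) = a j * v j $ i" if "i < n" "j < Suc m" for i j
  proof -
    have "(A *\<^sub>v v j) $ i = (\<Sum>k<n. A $$ (i, k) * v j $ k)"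
      using that(1) A v(1)[OF that(2)] by (auto simp: scalar_prod_def atLeast0LessThan intro!: sum.cong)
    then show ?thesis using v(1)[OF that(2)] that(1) by (simp add: v(3)[OF that(2)])
  qed
  have "(\<Sum>j<m. c j * (a j - a m) * v j $ i) = 0" if i: "i < n" for i
  proof -
    have "0 = (\<Sum>k<n. A $$ (i, k) * (\<Sum>j<Suc m. c j * v j $ k))" using Suc.prems(3) by simp
    also have "\<dots> = (\<Sum>j<Suc m. \<Sum>k<n. A $$ (i, k) * (c j * v j $ k))"
      unfolding sum_distrib_left by (rule sum.swap)
    also have "\<dots> = (\<Sum>j<Suc m. c j * (\<Sum>k<n. A $$ (i, k) * v j $ k))"
      by (simp add: sum_distrib_left mult.left_commute del: sum.lessThan_Suc)
    also have "\<dots> = (\<Sum>j<Suc m. c j * (a j * v j $ i))"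
      by (intro sum.cong refl) (simp add: Av i)
    finally have "(\<Sum>j<Suc m. c j * (a j * v j $ i)) - a m * (\<Sum>j<Suc m. c j * v j $ i) = 0"
      using Suc.prems(3)[OF i] by simp
    then show ?thesis
      by (simp add: sum_distrib_left sum_subtractf[symmetric] algebra_simps)
  qed
  then have "c j * (a j - a m) = 0" if "j < m" for j
    using Suc.prems(1,2) that by (intro Suc.IH[of "\<lambda>j. c j * (a j - a m)"]) (auto intro: inj_on_subset)
  moreover have "a j \<noteq> a m" if "j < m" for j
    using Suc.prems(2) that by (auto dest: inj_onD)
  ultimately have c: "c j = 0" if "j < m" for j using that by auto
  have "v m \<noteq> 0\<^sub>v n" using v by simp
  then obtain i where i: "i < n" "v m $ i \<noteq> 0" using v(1)[of m] by (auto simp: vec_eq_iff)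
  have "c m * v m $ i = 0" using Suc.prems(3)[OF i(1)] c by simp
  then have "c m = 0" using i(2) by simp
  with c show ?case using Suc.prems(4) by (cases "j = m") auto
qed simp

lemma invertible_mat_inverse:
  fixes X :: "'a::comm_ring_1 mat"
  assumes "X \<in> carrier_mat n n" "det X dvd 1"
  obtains Y where "Y \<in> carrier_mat n n" "X * Y = 1\<^sub>m n" "Y * X = 1\<^sub>m n"
proof -
  from assms(2) obtain c where c: "det X * c = 1" by (metis dvdE)
  show thesis
  proof
    show "c \<cdot>\<^sub>m adj_mat X \<in> carrier_mat n n" using adj_mat(1)[OF assms(1)] by simp
    show "X * (c \<cdot>\<^sub>m adj_mat X) = 1\<^sub>m n" "c \<cdot>\<^sub>m adj_mat X * X = 1\<^sub>m n"
      using adj_mat[OF assms(1)] assms(1) c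
      by (auto simp: mult_smult_distrib[of _ n n _ n] mult_smult_assoc_mat[of _ n n _ n] mult.commute)
  qed
qed

text \<open>Simple roots make the \<open>n\<close> eigenvalues distinct, so the eigenvectors form an
  invertible \<open>P\<close> that diagonalises \<open>A\<close>. Conjugation by \<open>P\<close>
  carries the commutant of \<open>A\<close> into that of a diagonal matrix with distinct
  entries.\<close>

lemma commutant_commutative_alg_closed:
  fixes A X Y :: "'a::alg_closed_field mat"
  assumes A: "A \<in> carrier_mat n n"
    and simple: "\<And>a. poly (char_poly A) a \<noteq> 0 \<or> poly (pderiv (char_poly A)) a \<noteq> 0"
    and X: "X \<in> carrier_mat n n" "X * A = A * X" and Y: "Y \<in> carrier_mat n n" "Y * A = A * Y"
  shows "X * Y = Y * X"
proof -
  let ?f = "char_poly A"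
  have monic: "monic ?f" and deg: "degree ?f = n" using degree_monic_char_poly[OF A] by auto
  then have "?f \<noteq> 0" by auto
  from alg_closed_imp_factorization[OF this] obtain R where
    R: "size R = n" "?f = smult (lead_coeff ?f) (\<Prod>x\<in>#R. [:-x, 1:])" using deg by auto
  obtain as where as: "mset as = R" using ex_mset by blast
  have len: "length as = n" using R(1) as by auto
  have "?f = (\<Prod>x\<in>#mset as. [:-x, 1:])" using R(2) monic as by simp
  then have f: "?f = (\<Prod>a\<leftarrow>as. [:-a, 1:])"
    by (metis mset_map prod_mset_prod_list)
  have "distinct as"
  proof (rule ccontr)
    assume "\<not> distinct as"
    \<comment> \<open>A repeated entry \<open>y\<close> gives the square of a linear factor, hence a
      common root with the derivative.\<close>
    then obtain xs ys zs y where dec: "as = xs @ [y] @ ys @ [y] @ zs" using not_distinct_decomp by blast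
    define l where "l a = [:-a, 1:]" for a :: 'a
    have "?f = prod_list (map l as)" unfolding f l_def ..
    also have "\<dots> = l y * (l y * prod_list (map l (xs @ ys @ zs)))" by (simp add: dec mult_ac)
    finally have "poly ?f y = 0" "poly (pderiv ?f) y = 0"
      by (simp_all add: pderiv_mult l_def[of y, THEN arg_cong, of "\<lambda>p. poly p y"])
    with simple[of y] show False by simp
  qed
  then have inj: "inj_on ((!) as) {..<n}" using len by (auto intro: inj_on_nth)
  have "eigenvalue A (as ! j)" if "j < n" for j
    unfolding eigenvalue_root_char_poly[OF A] f poly_prod_list using that len
    by (auto simp: prod_list_zero_iff)
  then obtain v where v: "\<And>j. j < n \<Longrightarrow> eigenvector A (v j) (as ! j)"
    unfolding eigenvalue_def by metis
  have vc: "v j \<in> carrier_vec n" "A *\<^sub>v v j = (as ! j) \<cdot>\<^sub>v v j" if "j < n" for j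
    using v[OF that] A unfolding eigenvector_def by auto
  define P where "P = mat n n (\<lambda>(i, j). v j $ i)"
  define D where "D = mat n n (\<lambda>(i, j). if i = j then as ! i else 0)"
  have P: "P \<in> carrier_mat n n" and D: "D \<in> carrier_mat n n" by (auto simp: P_def D_def)
  have "det P \<noteq> 0"
  proof
    assume "det P = 0"
    then obtain c where c: "c \<in> carrier_vec n" "c \<noteq> 0\<^sub>v n" "P *\<^sub>v c = 0\<^sub>v n"
      using det_0_iff_vec_prod_zero_field[OF P] by blast
    have "(\<Sum>j<n. c $ j * v j $ i) = 0" if i: "i < n" for i
    proof -
      have "(P *\<^sub>v c) $ i = (\<Sum>j<n. c $ j * v j $ i)"
        using i c(1) by (auto simp: P_def scalar_prod_def atLeast0LessThan mult.commute intro!: sum.cong)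
      then show ?thesis using c(3) i by simp
    qed
    then have "c $ j = 0" if "j < n" for j
      using eigenvectors_independent[OF A v inj _ that, of "\<lambda>j. c $ j"] by blast
    then have "c = 0\<^sub>v n" using c(1) by (intro eq_vecI) auto
    with c(2) show False ..
  qed
  then have "det P dvd 1" by (simp add: dvd_field_iff)
  from invertible_mat_inverse[OF P this] obtain Q where
    Q: "Q \<in> carrier_mat n n" "P * Q = 1\<^sub>m n" "Q * P = 1\<^sub>m n" by blast
  have AP: "A * P = P * D"
  proof (rule eq_matI)
    fix i j assume "i < dim_row (P * D)" "j < dim_col (P * D)"
    then have ij: "i < n" "j < n" using P D by auto
    have "(A * P) $$ (i, j) = (A *\<^sub>v v j) $ i"
      using ij A vc(1)[OF ij(2)] by (auto simp: P_def scalar_prod_def intro!: sum.cong)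
    also have "\<dots> = (as ! j) * v j $ i" using ij vc[OF ij(2)] by simp
    also have "\<dots> = (\<Sum>k<n. if k = j then (as ! j) * v j $ i else 0)" using ij by simp
    also have "\<dots> = (P * D) $$ (i, j)"
      unfolding index_mult_mat_sum[OF P D ij] using ij by (intro sum.cong refl) (auto simp: P_def D_def)
    finally show "(A * P) $$ (i, j) = (P * D) $$ (i, j)" .
  qed (use A P D in auto)
  have QA: "Q * A = D * Q"
  proof -
    have "Q * A = Q * (A * (P * Q))" using A Q by simp
    also have "\<dots> = Q * (A * P) * Q" using A P Q(1) by (simp add: assoc_mult_mat[of _ n n _ n _ n])
    also have "\<dots> = (Q * P) * D * Q" unfolding AP using D P Q(1) by (simp add: assoc_mult_mat[of _ n n _ n _ n])
    finally show ?thesis using Q D by simp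
  qed
  have conj: "(Q * Z * P) * D = D * (Q * Z * P)" if Z: "Z \<in> carrier_mat n n" "Z * A = A * Z" for Z
  proof -
    have "(Q * Z * P) * D = Q * Z * (A * P)"
      unfolding AP using P Q(1) D Z(1) by (simp add: assoc_mult_mat[of _ n n _ n _ n])
    also have "\<dots> = Q * (Z * A) * P" using P Q(1) A Z(1) by (simp add: assoc_mult_mat[of _ n n _ n _ n])
    also have "\<dots> = (Q * A) * Z * P"
      unfolding Z(2) using P Q(1) A Z(1) by (simp add: assoc_mult_mat[of _ n n _ n _ n])
    also have "\<dots> = D * (Q * Z * P)"
      unfolding QA using P Q(1) D Z(1) by (simp add: assoc_mult_mat[of _ n n _ n _ n])
    finally show ?thesis .
  qed
  have unconj: "P * ((Q * U * P) * (Q * V * P)) * Q = U * V"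
    if U: "U \<in> carrier_mat n n" and V: "V \<in> carrier_mat n n" for U V
  proof -
    have "P * ((Q * U * P) * (Q * V * P)) * Q = (P * Q) * (U * ((P * Q) * (V * (P * Q))))"
      using P Q(1) U V by (simp add: assoc_mult_mat[of _ n n _ n _ n])
    then show ?thesis using Q U V by simp
  qed
  have QZP: "Q * Z * P \<in> carrier_mat n n" if "Z \<in> carrier_mat n n" for Z
    using P Q(1) that by (intro mult_carrier_mat)
  have "(Q * X * P) * (Q * Y * P) = (Q * Y * P) * (Q * X * P)"
    by (rule commute_if_commute_with_diagonal[OF D _ inj QZP[OF X(1)] conj[OF X] QZP[OF Y(1)] conj[OF Y]])
      (simp add: D_def)
  with unconj[OF X(1) Y(1)] unconj[OF Y(1) X(1)] show ?thesis by simp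
qed

lemma (in comm_ring_hom) mat_hom_commute:
  assumes "X \<in> carrier_mat n n" "Y \<in> carrier_mat n n" "X * Y = Y * X"
  shows "map_mat hom X * map_mat hom Y = map_mat hom Y * map_mat hom X"
  using assms by (metis mat_hom_mult)

text \<open>Scalars are extended to the algebraic closure of the fraction field. The extension is
  injective on matrices, so the equality found there descends.\<close>

lemma commutant_commutative:
  fixes A X Y :: "'r::idom mat"
  assumes A: "A \<in> carrier_mat n n" and sep: "separable_poly (map_poly to_fract (char_poly A))"
    and X: "X \<in> carrier_mat n n" "X * A = A * X" and Y: "Y \<in> carrier_mat n n" "Y * A = A * Y"
  shows "X * Y = Y * X"
proof -
  define h where "h = to_ac \<circ> (to_fract :: 'r \<Rightarrow> 'r fract)"
  interpret ac: comm_ring_hom "to_ac :: 'r fract \<Rightarrow> 'r fract alg_closure"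
    by standard auto
  interpret h: inj_comm_ring_hom h
    by standard (auto simp: h_def)
  have hA: "map_mat h A \<in> carrier_mat n n" using A by simp
  have simple: "poly (char_poly (map_mat h A)) a \<noteq> 0 \<or> poly (pderiv (char_poly (map_mat h A))) a \<noteq> 0" for a
    using separable_poly_no_multiple_root[OF ac.comm_ring_hom_axioms sep, of a]
    unfolding h.char_poly_hom[OF A] by (simp add: map_poly_map_poly h_def)
  have "map_mat h X * map_mat h Y = map_mat h Y * map_mat h X"
    using X(1) Y(1)
    by (intro commutant_commutative_alg_closed[OF hA simple _ h.mat_hom_commute[OF X(1) A X(2)]
          _ h.mat_hom_commute[OF Y(1) A Y(2)]]) simp_all
  then have "map_mat h (X * Y) = map_mat h (Y * X)"
    using X(1) Y(1) by (simp add: h.mat_hom_mult[of _ n n _ n])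
  then show ?thesis by (rule h.mat_hom_inj)
qed

subsection \<open>Descent of similarity\<close>

theorem theorem6:
  fixes \<phi> :: "'r::discrete_valuation_ring fract \<Rightarrow> 'l::field"
    and A B :: "'r mat" and n :: nat
  defines "\<iota> \<equiv> \<phi> \<circ> to_fract"
  assumes "finite_field_extension \<phi>"
    and "A \<in> carrier_mat n n" and "B \<in> carrier_mat n n"
    and "char_poly A = char_poly B"
    and "separable_poly (map_poly to_fract (char_poly A))"
    and "similar_mat_over (integral_closure \<iota>) (map_mat \<iota> B) (map_mat \<iota> A)"
  shows "similar_mat B A"
proof -
  note A = \<open>A \<in> carrier_mat n n\<close> and B = \<open>B \<in> carrier_mat n n\<close>
  interpret \<phi>: field_hom \<phi> using assms(2) unfolding finite_field_extension_def by blast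
  interpret dvr_field_hom \<iota>
    by standard (auto simp: \<iota>_def \<phi>.hom_add \<phi>.hom_mult)
  obtain P Q where PQ: "elements_mat P \<subseteq> integral_closure \<iota>" "elements_mat Q \<subseteq> integral_closure \<iota>"
    and wit: "similar_mat_wit (map_mat \<iota> B) (map_mat \<iota> A) P Q"
    using assms(7) unfolding similar_mat_over_def by blast
  have \<iota>A: "map_mat \<iota> A \<in> carrier_mat n n" and \<iota>B: "map_mat \<iota> B \<in> carrier_mat n n" using A B by auto
  from similar_mat_witD2[OF \<iota>B wit] have P: "P \<in> carrier_mat n n" and Q: "Q \<in> carrier_mat n n"
    and inv: "P * Q = 1\<^sub>m n" "Q * P = 1\<^sub>m n" and BA: "map_mat \<iota> B = P * map_mat \<iota> A * Q" by auto
  \<comment> \<open>Clearing the inverse turns similarity into intertwining equations, which are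
    linear.\<close>
  have BP: "map_mat \<iota> B * P = P * map_mat \<iota> A"
  proof -
    have "map_mat \<iota> B * P = P * map_mat \<iota> A * (Q * P)"
      unfolding BA using P Q \<iota>A by (simp add: assoc_mult_mat[of _ n n _ n _ n])
    then show ?thesis using P \<iota>A inv by simp
  qed
  have QB: "map_mat \<iota> A * Q = Q * map_mat \<iota> B"
  proof -
    have "Q * map_mat \<iota> B = (Q * P) * (map_mat \<iota> A * Q)"
      unfolding BA using P Q \<iota>A by (simp add: assoc_mult_mat[of _ n n _ n _ n])
    then show ?thesis using Q \<iota>A inv by simp
  qed
  obtain F :: "('r mat \<times> 'r mat) set" where fin: "finite F"
    and F: "\<forall>(Y, X)\<in>F. Y \<in> carrier_mat n n \<and> X \<in> carrier_mat n n \<and> B * X = X * A \<and> A * Y = Y * B"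
    and faithful: "\<forall>z\<in>carrier_mat n n. z \<noteq> 0\<^sub>m n n \<longrightarrow> (\<exists>(Y, X)\<in>F. map_mat residue (Y * X) * z \<noteq> 0\<^sub>m n n)"
    using ex_intertwiners_not_killing[OF A B P PQ(1) BP Q PQ(2) QB inv(2)] by blast
  \<comment> \<open>These are reductions of intertwiners over the valuation ring, not all
    intertwiners of the reduced matrices. The characteristic polynomial of the reduced
    \<open>A\<close> may have multiple roots, and the full commutant over the residue field need not
    be commutative.\<close>
  define H where "H U V = map_mat residue ` {X \<in> carrier_mat n n. U * X = X * V}" for U V :: "'r mat"
  have H_carrier: "X \<in> carrier_mat n n" if "X \<in> H U V" for X U V using that by (auto simp: H_def)
  have H_zero: "0\<^sub>m n n \<in> H U V" if "U \<in> carrier_mat n n" "V \<in> carrier_mat n n" for U V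
  proof -
    have "0\<^sub>m n n = map_mat residue (0\<^sub>m n n)" by auto
    with that show ?thesis by (auto simp: H_def)
  qed
  have H_add: "X + X' \<in> H U V" if "X \<in> H U V" "X' \<in> H U V" "U \<in> carrier_mat n n" "V \<in> carrier_mat n n" for X X' U V
  proof -
    from that obtain Z Z' where Z: "Z \<in> carrier_mat n n" "U * Z = Z * V" "X = map_mat residue Z"
      and Z': "Z' \<in> carrier_mat n n" "U * Z' = Z' * V" "X' = map_mat residue Z'" by (auto simp: H_def)
    have "X + X' = map_mat residue (Z + Z')" using Z Z' by (auto simp: residue.hom_add)
    moreover have "U * (Z + Z') = (Z + Z') * V"
      using Z Z' that(3,4) by (simp add: mult_add_distrib_mat[of _ n n _ n] add_mult_distrib_mat[of _ n n _ _ n])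
    ultimately show ?thesis using Z(1) Z'(1) unfolding H_def by (intro image_eqI[of _ _ "Z + Z'"]) auto
  qed
  have H_mult: "X * X' \<in> H U V" if "X \<in> H U Z" "X' \<in> H Z V"
    "U \<in> carrier_mat n n" "Z \<in> carrier_mat n n" "V \<in> carrier_mat n n" for X X' U V Z
  proof -
    from that obtain M M' where M: "M \<in> carrier_mat n n" "U * M = M * Z" "X = map_mat residue M"
      and M': "M' \<in> carrier_mat n n" "Z * M' = M' * V" "X' = map_mat residue M'" by (auto simp: H_def)
    have "X * X' = map_mat residue (M * M')" using M M' by (simp add: residue.mat_hom_mult[of _ n n _ n])
    moreover have "U * (M * M') = (M * M') * V"
      by (metis assoc_mult_mat[OF that(3) M(1) M'(1)] assoc_mult_mat[OF M(1) that(4) M'(1)]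
          assoc_mult_mat[OF M(1) M'(1) that(5)] M(2) M'(2))
    ultimately show ?thesis using M(1) M'(1) unfolding H_def by (intro image_eqI[of _ _ "M * M'"]) auto
  qed
  \<comment> \<open>Here \<open>C\<close> is the reduced commutant of \<open>A\<close>, while
    \<open>W\<close> and \<open>W'\<close> are the reduced intertwiners in the two
    directions.\<close>
  interpret mat_morita_context n "H A A" "H B A" "H A B" "(\<lambda>(Y, X). (map_mat residue Y, map_mat residue X)) ` F"
  proof
    show "1\<^sub>m n \<in> H A A"
    proof -
      have "1\<^sub>m n = map_mat residue (1\<^sub>m n)" by auto
      with A show ?thesis by (auto simp: H_def)
    qed
    show "a \<cdot>\<^sub>m x \<in> H A A" if "x \<in> H A A" for a x
    proof -
      obtain c where c: "a = residue c" using surj_residue by (metis surjD)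
      from that obtain Z where Z: "Z \<in> carrier_mat n n" "A * Z = Z * A" "x = map_mat residue Z" by (auto simp: H_def)
      have "a \<cdot>\<^sub>m x = map_mat residue (c \<cdot>\<^sub>m Z)" using Z(3) c by (auto simp: residue.hom_mult)
      moreover have "A * (c \<cdot>\<^sub>m Z) = (c \<cdot>\<^sub>m Z) * A"
        using Z A by (simp add: mult_smult_distrib[of _ n n _ n] mult_smult_assoc_mat[of _ n n _ n])
      ultimately show ?thesis using Z(1) unfolding H_def by (intro image_eqI[of _ _ "c \<cdot>\<^sub>m Z"]) auto
    qed
    show "x * y = y * x" if "x \<in> H A A" "y \<in> H A A" for x y
    proof -
      from that obtain X Y where X: "X \<in> carrier_mat n n" "A * X = X * A" "x = map_mat residue X"
        and Y: "Y \<in> carrier_mat n n" "A * Y = Y * A" "y = map_mat residue Y" by (auto simp: H_def)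
      have "X * Y = Y * X" using commutant_commutative[OF A assms(6) X(1) X(2)[symmetric] Y(1) Y(2)[symmetric]] .
      then show ?thesis unfolding X(3) Y(3) using X(1) Y(1) by (intro residue.mat_hom_commute) auto
    qed
    show "\<exists>(Y, X)\<in>(\<lambda>(Y, X). (map_mat residue Y, map_mat residue X)) ` F. Y * X * z \<noteq> 0\<^sub>m n n"
      if z: "z \<in> H A A" "z \<noteq> 0\<^sub>m n n" for z
    proof -
      obtain Y X where YX: "(Y, X) \<in> F" "map_mat residue (Y * X) * z \<noteq> 0\<^sub>m n n"
        using faithful H_carrier[OF z(1)] z(2) by blast
      moreover have "map_mat residue (Y * X) = map_mat residue Y * map_mat residue X"
        using F YX(1) by (intro residue.mat_hom_mult) auto
      ultimately show ?thesis by (intro bexI[of _ "(map_mat residue Y, map_mat residue X)"]) auto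
    qed
    show "(\<lambda>(Y, X). (map_mat residue Y, map_mat residue X)) ` F \<subseteq> H A B \<times> H B A"
      using F by (auto simp: H_def)
  qed (use A B fin in \<open>auto intro: H_carrier H_zero H_add H_mult\<close>)
  obtain X Y where X: "X \<in> carrier_mat n n" "B * X = X * A" and Y: "Y \<in> carrier_mat n n"
    and YX: "map_mat residue Y * map_mat residue X = 1\<^sub>m n"
    using ex_invertible by (auto simp: H_def)
  \<comment> \<open>The determinant of the lift \<open>X\<close> has nonzero residue, so it is a
    unit and \<open>X\<close> is invertible over the valuation ring.\<close>
  have "residue (det Y) * residue (det X) = det (map_mat residue Y * map_mat residue X)"
    using X Y by (subst det_mult[of _ n]) auto
  then have "residue (det X) \<noteq> 0" unfolding YX by auto
  then have "det X dvd 1" by (simp add: residue_eq_0_iff)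
  from invertible_mat_inverse[OF X(1) this] obtain X' where
    X': "X' \<in> carrier_mat n n" and XX': "X * X' = 1\<^sub>m n" "X' * X = 1\<^sub>m n" by blast
  have "B = X * A * X'"
    unfolding X(2)[symmetric] using assoc_mult_mat[OF B X(1) X'] B by (simp add: XX')
  then show ?thesis
    using A B X(1) X' XX' unfolding similar_mat_def similar_mat_wit_def Let_def
    by (intro exI[of _ X] exI[of _ X']) auto
qed

end
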